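(* Let $-\infty\le l_1<u_1\le\infty$ and $-\infty\le l_2<u_2\le\infty$ be independent of the parameter vector $\lambda$, and let $z=(z_1,z_2)\in(l_1,u_1)\times(l_2,u_2)$ have joint density $q(z\mid\lambda)=q(z_1\mid\lambda)\,q(z_2\mid z_1,\lambda)$, where $$q(z_1\mid\lambda)=h_1(z_1)\exp\{\langle T_1(z_1),\phi_1(\lambda)\rangle-A_1(\lambda)\},\qquad q(z_2\mid z_1,\lambda)=h_2(z_2,z_1)\exp\{\langle T_2(z_2,z_1),\phi_2(\lambda)\rangle-A_2(\lambda,z_1)\}$$ are positive densities, differentiable in $\lambda$, such that $q(z_1\mid\lambda)$ is locally AC in $z_1$, $q(z_2\mid z_1,\lambda)$ is locally ACL in $(z_1,z_2)$, and $q(z_1,z_2\mid\lambda)$ is continuous in $(z_1,z_2)$. Let $\psi_1(z_1,\lambda)=\int_{l_1}^{z_1}q(t_1\mid\lambda)\,dt_1$, $\psi_2(z_1,z_2,\lambda)=\int_{l_2}^{z_2}q(t_2\mid z_1,\lambda)\,dt_2$, and $$\Psi(z,\lambda)=\begin{bmatrix}\psi_1(z_1,\lambda)\\ \psi_2(z_1,z_2,\lambda)\end{bmatrix},\quad \nabla_{\lambda_i}\Psi(z,\lambda)=\begin{bmatrix}\nabla_{\lambda_i}\psi_1(z_1,\lambda)\\ \nabla_{\lambda_i}\psi_2(z_1,z_2,\lambda)\end{bmatrix},\quad \nabla_z\Psi(z,\lambda)=\begin{bmatrix}q(z_1\mid\lambda)&0\\ \nabla_{z_1}\psi_2(z_1,z_2,\lambda)&q(z_2\mid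 z_1,\lambda)\end{bmatrix}.$$ Let $h:(l_1,u_1)\times(l_2,u_2)\to\mathbb{R}$ be locally ACL and continuous. For a scalar component $\lambda_i$ of $\lambda$ and $j\in\{1,2\}$ define $$f_{i,j}(z):=e_j^T[\nabla_z\Psi(z,\lambda)]^{-1}\nabla_{\lambda_i}\Psi(z,\lambda),$$ $$\tilde f_{i,1}(z_1):=f_{i,1}(z)\,h(z)\,q(z_2\mid z_1,\lambda)\ \ (z_2\text{ fixed}),\qquad \tilde f_{i,2}(z_2):=f_{i,2}(z)\,h(z)\ \ (z_1\text{ fixed}).$$ Assume the following. (1) For almost every $z_2$, $\tilde f_{i,1}$ is locally AC on $(l_1,u_1)$ and $\tilde f_{i,1}(z_1)q(z_1\mid\lambda)\to0$ as $z_1\downarrow l_1$ and as $z_1\uparrow u_1$. For almost every $z_1$, $\tilde f_{i,2}$ is locally AC on $(l_2,u_2)$ and $\tilde f_{i,2}(z_2)q(z_2\mid z_1,\lambda)\to0$ as $z_2\downarrow l_2$ and as $z_2\uparrow u_2$. (2) The following integrals are absolutely convergent: $$\iint \nabla_{z_1}\tilde f_{i,1}\;q(z_1\mid\lambda)\,dz_1dz_2,\qquad \iint \tilde f_{i,1}\,\nabla_{z_1}q(z_1\mid\lambda)\,dz_1dz_2,$$ $$\mathbb{E}_q[\nabla_{z_2}\tilde f_{i,2}],\qquad \mathbb{E}_q\Big[\tilde f_{i,2}\frac{\nabla_{z_2}q(z_2\mid z_1,\lambda)}{q(z_2\mid z_1,\lambda)}\Big],\qquad \mathbb{E}_q[h],\qquad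 \mathbb{E}_q\Big[h\frac{\nabla_{\lambda_i}q(z\mid\lambda)}{q(z\mid\lambda)}\Big],\qquad \mathbb{E}_q\Big[\sum_j f_{i,j}\nabla_{z_j}h\Big].$$ (3) Differentiation and integration may be interchanged: $$\nabla_{\lambda_i}\mathbb{E}_q[h(z)]=\mathbb{E}_q\Big[h(z)\frac{\nabla_{\lambda_i}q(z\mid\lambda)}{q(z\mid\lambda)}\Big],\qquad \nabla_{\lambda_i}\psi_1=\int_{l_1}^{z_1}\nabla_{\lambda_i}q(t_1\mid\lambda)\,dt_1,$$ $$\nabla_{\lambda_i}\psi_2=\int_{l_2}^{z_2}\nabla_{\lambda_i}q(t_2\mid z_1,\lambda)\,dt_2,\qquad \nabla_{z_1}\psi_2=\int_{l_2}^{z_2}\nabla_{z_1}q(t_2\mid z_1,\lambda)\,dt_2.$$ Then $$\nabla_{\lambda_i}\mathbb{E}_q[h(z)]=-\mathbb{E}_q\Big[\sum_{j=1}^2 f_{i,j}(z)\,\nabla_{z_j}h(z)\Big].$$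
   Context: $\mathbb{E}_q$ is expectation under $q(z_1,z_2\mid\lambda)$; $e_j$ is the $j$-th standard basis vector of $\mathbb{R}^2$; $\langle\cdot,\cdot\rangle$ is the Euclidean inner product; $\nabla_{x}$ with scalar $x$ is the partial derivative in $x$ (in the $z$ variables, possibly existing only almost everywhere). A function $g:[a,b]\to\mathbb{R}$ is absolutely continuous (AC) if its derivative exists almost everywhere on $[a,b]$, is Lebesgue integrable, and $g(x)=g(a)+\int_a^x g'(t)\,dt$ for all $x\in[a,b]$. A function on an open interval $(l,u)$ is locally AC if it is AC on every compact interval inside $(l,u)$. A function on $(l_1,u_1)\times(l_2,u_2)$ is locally ACL if for each coordinate $i$ and almost every fixed value of the other coordinate, it is locally AC as a function of $z_i$ on $(l_i,u_i)$. *)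

theory Defs
  imports "HOL-Analysis.Analysis"
begin

text \<open>All functions are total in HOL; only their values on the open interval
  \<open>einterval l u\<close> (with extended real endpoints), resp. on the open box, matter.  Integrals are
  taken with respect to the completed Lebesgue measure \<open>lebesgue\<close>.\<close>

subsection \<open>Absolute continuity\<close>

text \<open>The endpoints of the interval are a null set, so it is harmless that \<open>deriv g\<close> is the
  two-sided derivative.\<close>

definition AC_on :: "real \<Rightarrow> real \<Rightarrow> (real \<Rightarrow> real) \<Rightarrow> bool" where
  "AC_on a b g \<longleftrightarrow>
     (AE t in lebesgue_on {a..b}. g field_differentiable (at t)) \<and>
     set_integrable lebesgue {a..b} (deriv g) \<and>
     (\<forall>x\<in>{a..b}. g x = g a + (LINT t:{a..x}|lebesgue. deriv g t))"

definition loc_AC :: "ereal \<Rightarrow> ereal \<Rightarrow> (real \<Rightarrow> real) \<Rightarrow> bool" where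
  "loc_AC l u g \<longleftrightarrow> (\<forall>a b. a \<le> b \<and> {a..b} \<subseteq> einterval l u \<longrightarrow> AC_on a b g)"

definition box2 :: "ereal \<Rightarrow> ereal \<Rightarrow> ereal \<Rightarrow> ereal \<Rightarrow> (real \<times> real) set" where
  "box2 l1 u1 l2 u2 = einterval l1 u1 \<times> einterval l2 u2"

definition loc_ACL :: "ereal \<Rightarrow> ereal \<Rightarrow> ereal \<Rightarrow> ereal \<Rightarrow> (real \<times> real \<Rightarrow> real) \<Rightarrow> bool" where
  "loc_ACL l1 u1 l2 u2 g \<longleftrightarrow>
     (AE z2 in lebesgue_on (einterval l2 u2). loc_AC l1 u1 (\<lambda>z1. g (z1, z2))) \<and>
     (AE z1 in lebesgue_on (einterval l1 u1). loc_AC l2 u2 (\<lambda>z2. g (z1, z2)))"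

text \<open>The function tends to \<open>0\<close> at both ends of the interval; the filters live on \<^typ>\<open>ereal\<close>, so
  this also covers infinite endpoints.\<close>

definition vanishes_at_ends :: "ereal \<Rightarrow> ereal \<Rightarrow> (real \<Rightarrow> real) \<Rightarrow> bool" where
  "vanishes_at_ends l u g \<longleftrightarrow>
     ((\<lambda>x. g (real_of_ereal x)) \<longlongrightarrow> 0) (at_right l) \<and>
     ((\<lambda>x. g (real_of_ereal x)) \<longlongrightarrow> 0) (at_left u)"

subsection \<open>Partial derivatives\<close>

definition has_param_deriv :: "'n::finite \<Rightarrow> (real ^ 'n \<Rightarrow> real) \<Rightarrow> real \<Rightarrow> real ^ 'n \<Rightarrow> bool" where
  "has_param_deriv i F D \<theta> \<longleftrightarrow>
     ((\<lambda>s. F (\<theta> + s *\<^sub>R axis i 1)) has_real_derivative D) (at 0)"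

definition param_deriv :: "'n::finite \<Rightarrow> (real ^ 'n \<Rightarrow> real) \<Rightarrow> real ^ 'n \<Rightarrow> real" where
  "param_deriv i F \<theta> = deriv (\<lambda>s. F (\<theta> + s *\<^sub>R axis i 1)) 0"

definition z_deriv :: "2 \<Rightarrow> (real \<times> real \<Rightarrow> real) \<Rightarrow> real \<times> real \<Rightarrow> real" where
  "z_deriv j g z =
     (if j = 1 then deriv (\<lambda>x. g (x, snd z)) (fst z) else deriv (\<lambda>x. g (fst z, x)) (snd z))"

subsection \<open>Densities\<close>

definition positive_density :: "ereal \<Rightarrow> ereal \<Rightarrow> (real \<Rightarrow> real) \<Rightarrow> bool" where
  "positive_density l u p \<longleftrightarrow>
     (\<forall>x\<in>einterval l u. 0 < p x) \<and>
     set_integrable lebesgue (einterval l u) p \<and>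
     (LINT x:einterval l u|lebesgue. p x) = 1"

text \<open>Argument order: \<open>q1 \<theta> z1\<close> is the density of the first coordinate and \<open>q2 \<theta> z1 z2\<close> the
  conditional density of the second coordinate \<open>z2\<close> given the first coordinate \<open>z1\<close>.\<close>

definition joint ::
  "(real ^ 'n \<Rightarrow> real \<Rightarrow> real) \<Rightarrow> (real ^ 'n \<Rightarrow> real \<Rightarrow> real \<Rightarrow> real) \<Rightarrow> real ^ 'n \<Rightarrow> real \<times> real \<Rightarrow> real" where
  "joint q1 q2 \<theta> z = q1 \<theta> (fst z) * q2 \<theta> (fst z) (snd z)"

definition dens_measure :: "(real \<times> real) set \<Rightarrow> (real \<times> real \<Rightarrow> real) \<Rightarrow> (real \<times> real) measure" where
  "dens_measure R q = density (lebesgue_on R) (\<lambda>z. ennreal (q z))"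

subsection \<open>The standardization function\<close>

definition psi1 :: "ereal \<Rightarrow> (real ^ 'n \<Rightarrow> real \<Rightarrow> real) \<Rightarrow> real \<Rightarrow> real ^ 'n \<Rightarrow> real" where
  "psi1 l1 q1 z1 \<theta> = (LINT t=l1..ereal z1|lebesgue. q1 \<theta> t)"

definition psi2 ::
  "ereal \<Rightarrow> (real ^ 'n \<Rightarrow> real \<Rightarrow> real \<Rightarrow> real) \<Rightarrow> real \<Rightarrow> real \<Rightarrow> real ^ 'n \<Rightarrow> real" where
  "psi2 l2 q2 z1 z2 \<theta> = (LINT t=l2..ereal z2|lebesgue. q2 \<theta> z1 t)"

definition param_grad_Psi ::
  "ereal \<Rightarrow> ereal \<Rightarrow> (real ^ 'n::finite \<Rightarrow> real \<Rightarrow> real) \<Rightarrow> (real ^ 'n \<Rightarrow> real \<Rightarrow> real \<Rightarrow> real) \<Rightarrow>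
   real ^ 'n \<Rightarrow> 'n \<Rightarrow> real \<times> real \<Rightarrow> real ^ 2" where
  "param_grad_Psi l1 l2 q1 q2 \<theta> i z =
     vector [param_deriv i (psi1 l1 q1 (fst z)) \<theta>,
             param_deriv i (psi2 l2 q2 (fst z) (snd z)) \<theta>]"

definition z_grad_Psi ::
  "ereal \<Rightarrow> (real ^ 'n \<Rightarrow> real \<Rightarrow> real) \<Rightarrow> (real ^ 'n \<Rightarrow> real \<Rightarrow> real \<Rightarrow> real) \<Rightarrow>
   real ^ 'n \<Rightarrow> real \<times> real \<Rightarrow> real ^ 2 ^ 2" where
  "z_grad_Psi l2 q1 q2 \<theta> z =
     vector [vector [q1 \<theta> (fst z), 0],
             vector [z_deriv 1 (\<lambda>w. psi2 l2 q2 (fst w) (snd w) \<theta>) z, q2 \<theta> (fst z) (snd z)]]"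

definition f_imp ::
  "ereal \<Rightarrow> ereal \<Rightarrow> (real ^ 'n::finite \<Rightarrow> real \<Rightarrow> real) \<Rightarrow> (real ^ 'n \<Rightarrow> real \<Rightarrow> real \<Rightarrow> real) \<Rightarrow>
   real ^ 'n \<Rightarrow> 'n \<Rightarrow> 2 \<Rightarrow> real \<times> real \<Rightarrow> real" where
  "f_imp l1 l2 q1 q2 \<theta> i j z =
     axis j 1 \<bullet> (matrix_inv (z_grad_Psi l2 q1 q2 \<theta> z) *v param_grad_Psi l1 l2 q1 q2 \<theta> i z)"

end

theory Submission
  imports Defs
begin

text \<open>
  Write \<open>a\<close>, \<open>b\<close> for the \<open>\<lambda>\<^sub>i\<close>-derivatives of \<open>\<psi>\<^sub>1\<close>, \<open>\<psi>\<^sub>2\<close> and \<open>c\<close> for the \<open>z\<^sub>1\<close>-derivative of \<open>\<psi>\<^sub>2\<close>, so that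
  \<open>f\<^sub>1 q\<^sub>1 = a\<close> and \<open>f\<^sub>2 q\<^sub>2 = b - c f\<^sub>1\<close>.  Integrating by parts in \<open>z\<^sub>1\<close> and in \<open>z\<^sub>2\<close>, the functions
  \<open>\<partial>\<^sub>1(f\<^sub>1 h q\<^sub>2 q\<^sub>1) = \<partial>\<^sub>1(a h q\<^sub>2)\<close> and \<open>q\<^sub>1 \<partial>\<^sub>2(f\<^sub>2 h q\<^sub>2) = q\<^sub>1 \<partial>\<^sub>2((b - c f\<^sub>1) h)\<close> integrate to \<open>0\<close>.
  By the Lebesgue differentiation theorem the derivatives of \<open>a\<close>, \<open>b\<close>, \<open>c\<close> in their upper limits of
  integration are \<open>\<nabla> q\<^sub>1\<close>, \<open>\<nabla> q\<^sub>2\<close> (in \<open>\<lambda>\<^sub>i\<close>) and \<open>\<partial>\<^sub>1 q\<^sub>2\<close>; the two terms \<open>a h \<partial>\<^sub>1 q\<^sub>2\<close> cancel and the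
  sum of the two functions is \<open>h \<nabla> q + q (f\<^sub>1 \<partial>\<^sub>1 h + f\<^sub>2 \<partial>\<^sub>2 h)\<close> almost everywhere.
\<close>

subsection \<open>Fubini for the completed Lebesgue measure\<close>

text \<open>A function measurable for the completed measure agrees almost everywhere with a Borel
  one. The representative makes Fubini available, since
  \<open>lborel \<Otimes>\<^sub>M lborel\<close> is \<open>lborel\<close> on the plane.\<close>

lemma integrable_lebesgue_borel_version:
  fixes f :: "'a::euclidean_space \<Rightarrow> real"
  assumes "integrable lebesgue f"
  obtains f' where "integrable lborel f'" "AE x in lborel. f x = f' x"
    "(LINT x|lebesgue. f x) = (LINT x|lborel. f' x)"
proof -
  have m: "f \<in> borel_measurable (completion lborel)"
    using assms by auto
  obtain f' where f': "f' \<in> borel_measurable lborel" "AE x in lborel. f x = f' x"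
    using completion_ex_borel_measurable_real[OF m] by auto
  have ae: "AE x in lebesgue. f x = f' x"
    using f'(2) by (rule AE_completion)
  have m': "f' \<in> borel_measurable lebesgue"
    using f'(1) by (rule measurable_completion)
  have "integrable lebesgue f'"
    using assms integrable_cong_AE[OF m m' ae] by simp
  moreover have "(LINT x|lebesgue. f x) = (LINT x|lborel. f' x)"
    using integral_cong_AE[OF m m' ae] integral_completion[OF f'(1)] by simp
  ultimately show thesis
    using f' integrable_completion[OF f'(1)] by (intro that) auto
qed

text \<open>The way back from the representative, needed for sections: completeness of the measure
  makes \<open>g\<close> measurable.\<close>

lemma lebesgue_integral_borel_version:
  fixes g g' :: "'a::euclidean_space \<Rightarrow> real"
  assumes g': "integrable lborel g'" and ae: "AE y in lborel. g y = g' y"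
  shows "integrable lebesgue g" "(LINT y|lebesgue. g y) = (LINT y|lborel. g' y)"
proof -
  have m: "g' \<in> borel_measurable lebesgue" "g' \<in> borel_measurable lborel" "integrable lebesgue g'"
    using g' by (auto intro!: measurable_completion simp: integrable_completion)
  have ae': "AE y in lebesgue. g' y = g y"
    using ae by (auto intro!: AE_completion)
  have mg: "g \<in> borel_measurable lebesgue"
    by (rule borel_measurable_AE[OF m(1) ae'])
  show "integrable lebesgue g" "(LINT y|lebesgue. g y) = (LINT y|lborel. g' y)"
    using integrable_cong_AE[OF m(1) mg ae'] integral_cong_AE[OF m(1) mg ae'] m integral_completion[OF m(2)]
    by simp_all
qed

text \<open>The exceptional set lies in a Borel null set, almost all of whose sections are null.
  Swapping the coordinates gives the second order.\<close>

lemma lborel_AE_Pair: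
  fixes P :: "real \<times> real \<Rightarrow> bool"
  assumes "AE z in lebesgue. P z"
  shows "AE x in lborel. AE y in lborel. P (x, y)" "AE y in lborel. AE x in lborel. P (x, y)"
proof -
  have *: "AE z in lborel \<Otimes>\<^sub>M lborel. P z"
    using assms unfolding lborel_prod by (simp add: AE_completion_iff)
  then show "AE x in lborel. AE y in lborel. P (x, y)"
    by (rule lborel_pair.AE_pair)
  have "AE z in distr (lborel \<Otimes>\<^sub>M lborel) (lborel \<Otimes>\<^sub>M lborel) (\<lambda>(x, y). (y, x)). P z"
    using * lborel_pair.distr_pair_swap by metis
  then have "AE z in lborel \<Otimes>\<^sub>M lborel. P (case z of (x, y) \<Rightarrow> (y, x))"
    by (rule AE_distrD[OF measurable_pair_swap'])
  then show "AE y in lborel. AE x in lborel. P (x, y)"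
    using lborel_pair.AE_pair by fastforce
qed

text \<open>By Fubini almost every section is integrable, so the premise may be restricted to
  integrable sections and its user need not establish their integrability. The disjunction offers
  both orders of integration.\<close>

lemma integral_lebesgue_eq_0_if_sections:
  fixes f :: "real \<times> real \<Rightarrow> real"
  assumes f: "integrable lebesgue f"
    and "(AE x in lborel. integrable lebesgue (\<lambda>y. f (x, y)) \<longrightarrow> (LINT y|lebesgue. f (x, y)) = 0) \<or>
         (AE y in lborel. integrable lebesgue (\<lambda>x. f (x, y)) \<longrightarrow> (LINT x|lebesgue. f (x, y)) = 0)"
  shows "(LINT z|lebesgue. f z) = 0"
proof -
  obtain f' where f': "integrable lborel f'" "AE x in lborel. f x = f' x"
    "(LINT x|lebesgue. f x) = (LINT x|lborel. f' x)"
    using integrable_lebesgue_borel_version[OF f] .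
  have fi: "integrable (lborel \<Otimes>\<^sub>M lborel) f'" and fi': "integrable (lborel \<Otimes>\<^sub>M lborel) (\<lambda>(x, y). f' (x, y))"
    using f'(1) by (simp_all add: lborel_prod)
  have eq: "AE z in lebesgue. f z = f' z"
    using f'(2) by (rule AE_completion)
  have transfer: "(LINT y|lebesgue. g y) = (LINT y|lborel. g' y) \<and> integrable lebesgue g"
    if "integrable lborel g'" "AE y in lborel. g y = g' y" for g g' :: "real \<Rightarrow> real"
    using lebesgue_integral_borel_version[OF that] by simp
  have "(LINT z|lborel. f' z) = 0"
    using assms(2)
  proof
    assume z: "AE x in lborel. integrable lebesgue (\<lambda>y. f (x, y)) \<longrightarrow> (LINT y|lebesgue. f (x, y)) = 0"
    have "AE x in lborel. (LINT y|lborel. f' (x, y)) = 0"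
      using z lborel_AE_Pair(1)[OF eq] lborel_pair.AE_integrable_fst'[OF fi]
      by eventually_elim (use transfer in metis)
    then have "(LINT x|lborel. LINT y|lborel. f' (x, y)) = 0"
      by (rule integral_eq_zero_AE)
    then show ?thesis
      using lborel_pair.integral_fst'[OF fi] by (simp add: lborel_prod)
  next
    assume z: "AE y in lborel. integrable lebesgue (\<lambda>x. f (x, y)) \<longrightarrow> (LINT x|lebesgue. f (x, y)) = 0"
    have "AE y in lborel. (LINT x|lborel. f' (x, y)) = 0"
      using z lborel_AE_Pair(2)[OF eq] lborel_pair.AE_integrable_snd[OF fi']
      by eventually_elim (use transfer in metis)
    then have "(LINT y|lborel. LINT x|lborel. f' (x, y)) = 0"
      by (rule integral_eq_zero_AE)
    then show ?thesis
      using lborel_pair.integral_snd[OF fi'] by (simp add: lborel_prod)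
  qed
  with f'(3) show ?thesis by simp
qed

text \<open>The plane is the union of the half planes \<open>s \<le> t\<close> and
  \<open>t \<le> s\<close>; Fubini on each half yields one summand, and the whole product integral
  is the right-hand side.\<close>

lemma integral_product_triangle:
  fixes u v :: "real \<Rightarrow> real"
  assumes u: "integrable lborel u" and v: "integrable lborel v"
  shows "integrable lborel (\<lambda>t. v t * (LBINT s:{..t}. u s))" (is ?i)
    and "(LBINT t. v t * (LBINT s:{..t}. u s)) + (LBINT t. u t * (LBINT s:{..t}. v s))
          = (LBINT t. u t) * (LBINT t. v t)" (is ?e)
proof -
  \<comment> \<open>\<open>K u v\<close> is the product restricted to \<open>s \<le> t\<close>. As a
    function of \<open>u\<close> and \<open>v\<close> it also describes the other half, as
    \<open>K v u\<close> with swapped coordinates.\<close>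
  define K where "K = (\<lambda>u v::real\<Rightarrow>real. \<lambda>z::real\<times>real. v (fst z) * (indicator {..fst z} (snd z) * u (snd z)))"
  have prod: "integrable (lborel \<Otimes>\<^sub>M lborel) (\<lambda>z. v (fst z) * u (snd z))"
    if [measurable]: "integrable lborel u" "integrable lborel v" for u v :: "real \<Rightarrow> real"
    by (rule lborel_pair.Fubini_integrable) (use that in \<open>auto simp: abs_mult\<close>)
  have K: "integrable (lborel \<Otimes>\<^sub>M lborel) (K u v)"
    if [measurable]: "integrable lborel u" "integrable lborel v" for u v :: "real \<Rightarrow> real"
    using prod[OF that] unfolding K_def
    by (rule Bochner_Integration.integrable_bound) (auto simp: abs_mult indicator_def intro!: AE_I2 mult_left_mono)
  have sec: "(LBINT s. K u v (t, s)) = v t * (LBINT s:{..t}. u s)" for t and u v :: "real \<Rightarrow> real"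
    by (simp add: K_def set_lebesgue_integral_def)
  show ?i
    using lborel_pair.integrable_fst'[OF K[OF u v]] by (simp add: sec)
  have int: "(LINT z|(lborel \<Otimes>\<^sub>M lborel). K u v z) = (LBINT t. v t * (LBINT s:{..t}. u s))"
    if "integrable lborel u" "integrable lborel v" for u v :: "real \<Rightarrow> real"
    using lborel_pair.integral_fst'[OF K[OF that]] by (simp add: sec)
  have "(LBINT t. u t * (LBINT s:{..t}. v s)) = (LINT z|(lborel \<Otimes>\<^sub>M lborel). K v u (snd z, fst z))"
    using lborel_pair.integral_product_swap[of "K v u"] K[OF v u] int[OF v u] by (simp add: case_prod_unfold)
  moreover have sw: "integrable (lborel \<Otimes>\<^sub>M lborel) (\<lambda>z. K v u (snd z, fst z))"
    using lborel_pair.integrable_product_swap[OF K[OF v u]] by (simp add: case_prod_unfold)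
  ultimately have "(LBINT t. v t * (LBINT s:{..t}. u s)) + (LBINT t. u t * (LBINT s:{..t}. v s))
      = (LINT z|(lborel \<Otimes>\<^sub>M lborel). K u v z + K v u (snd z, fst z))"
    using int[OF u v] K[OF u v] by simp
  also have "\<dots> = (LBINT t. LBINT s. K u v (t, s) + K v u (s, t))"
    using lborel_pair.integral_fst'[OF Bochner_Integration.integrable_add[OF K[OF u v] sw]] by simp
  also have "\<dots> = (LBINT t. LBINT s. v t * u s)"
  proof (rule Bochner_Integration.integral_cong[OF refl])
    fix t
    have [measurable]: "u \<in> borel_measurable borel" "v \<in> borel_measurable borel"
      using u v by auto
    show "(LBINT s. K u v (t, s) + K v u (s, t)) = (LBINT s. v t * u s)"
    proof (rule integral_cong_AE)
      have "indicat_real {..s} t = indicator {t..} s" for s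
        by (simp add: indicator_def)
      then show "(\<lambda>s. K u v (t, s) + K v u (s, t)) \<in> borel_measurable lborel"
        by (simp add: K_def)
      \<comment> \<open>The two half planes share the diagonal, so the null set \<open>s = t\<close>
        has to be left out.\<close>
      show "AE s in lborel. K u v (t, s) + K v u (s, t) = v t * u s"
        using AE_lborel_singleton[of t] by eventually_elim (auto simp: K_def indicator_def)
    qed (simp_all add: K_def)
  qed
  finally show ?e by (simp add: mult.commute)
qed

subsection \<open>Absolutely continuous functions\<close>

lemma AC_on_continuous_on:
  assumes "AC_on a b g"
  shows "continuous_on {a..b} g"
proof -
  have si: "set_integrable lebesgue {a..b} (deriv g)"
    and eq: "\<And>x. x \<in> {a..b} \<Longrightarrow> g x = g a + (LINT t:{a..x}|lebesgue. deriv g t)"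
    using assms unfolding AC_on_def by blast+
  have "continuous_on {a..b} (\<lambda>x. g a + integral {a..x} (deriv g))"
    by (intro continuous_intros indefinite_integral_continuous_1 set_lebesgue_integral_eq_integral(1)[OF si])
  moreover have "g x = g a + integral {a..x} (deriv g)" if "x \<in> {a..b}" for x
  proof -
    have "set_integrable lebesgue {a..x} (deriv g)"
      by (rule set_integrable_subset[OF si]) (use that in auto)
    then show ?thesis
      using eq[OF that] set_lebesgue_integral_eq_integral(2) by metis
  qed
  ultimately show ?thesis
    by (metis (no_types, lifting) continuous_on_cong)
qed

lemma einterval_subset_Icc:
  assumes "x \<in> einterval l u"
  obtains a b where "a < x" "x < b" "{a..b} \<subseteq> einterval l u"
proof -
  obtain e where "e > 0" "cball x e \<subseteq> einterval l u"
    using assms open_contains_cball open_einterval by metis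
  then show thesis
    by (intro that[of "x - e" "x + e"]) (auto simp: cball_eq_atLeastAtMost)
qed

lemma loc_AC_continuous_on:
  assumes "loc_AC l u g"
  shows "continuous_on (einterval l u) g"
proof -
  have "isCont g x" if x: "x \<in> einterval l u" for x
  proof -
    obtain a b where ab: "a < x" "x < b" "{a..b} \<subseteq> einterval l u"
      using einterval_subset_Icc[OF x] .
    then have "continuous_on {a..b} g"
      using assms by (intro AC_on_continuous_on) (auto simp: loc_AC_def)
    then show ?thesis
      using ab by (simp add: continuous_on_interior)
  qed
  then show ?thesis
    by (simp add: continuous_at_imp_continuous_on)
qed

text \<open>Countably many compact intervals exhaust the open one, so their exceptional null sets
  have a null union.\<close>

lemma loc_AC_AE_differentiable:
  assumes "loc_AC l u g"
  shows "AE x in lborel. x \<in> einterval l u \<longrightarrow> g field_differentiable (at x)"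
proof (cases "l < u")
  case True
  obtain a b :: "nat \<Rightarrow> real" where ab: "einterval l u = (\<Union>i. {a i..b i})" "\<And>i. a i < b i"
    using einterval_Icc_approximation[OF True] by metis
  have "AE x in lborel. x \<in> {a i..b i} \<longrightarrow> g field_differentiable (at x)" for i
  proof -
    have "AC_on (a i) (b i) g"
      using assms ab unfolding loc_AC_def by (metis UN_upper UNIV_I less_imp_le)
    then show ?thesis
      by (simp add: AC_on_def AE_restrict_space_iff AE_completion_iff)
  qed
  then have "AE x in lborel. \<forall>i. x \<in> {a i..b i} \<longrightarrow> g field_differentiable (at x)"
    unfolding AE_all_countable by blast
  then show ?thesis
    by eventually_elim (auto simp: ab)
next
  case False
  then have "einterval l u = {}"
    by (auto simp: einterval_def intro: less_trans)
  then show ?thesis by simp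
qed

text \<open>The product \<open>g' \<otimes> p'\<close> is integrated over the square \<open>{a..b} \<times> {a..b}\<close>, cut along the diagonal.\<close>

lemma AC_on_integration_by_parts:
  assumes ab: "a \<le> b" and g: "AC_on a b g" and p: "AC_on a b p"
  shows "(LINT t:{a..b}|lebesgue. deriv g t * p t + g t * deriv p t) = g b * p b - g a * p a"
proof -
  \<comment> \<open>Extending the derivative by 0 turns primitives starting at \<open>a\<close> into
    integrals over \<open>{..t}\<close>, the form used for the triangles.\<close>
  define D where "D = (\<lambda>g t. indicator {a..b} t * deriv g t :: real)"
  have D: "integrable lebesgue (D g)" "\<And>t. t \<in> {a..b} \<Longrightarrow> (LINT s|lebesgue. indicator {..t} s * D g s) = g t - g a"
    if "AC_on a b g" for g
  proof -
    show "integrable lebesgue (D g)"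
      using that by (simp add: AC_on_def set_integrable_def D_def)
    show "(LINT s|lebesgue. indicator {..t} s * D g s) = g t - g a" if t: "t \<in> {a..b}" for t
    proof -
      have "(LINT s|lebesgue. indicator {..t} s * D g s) = (LINT s:{a..t}|lebesgue. deriv g s)"
        unfolding set_lebesgue_integral_def D_def using t
        by (intro Bochner_Integration.integral_cong) (auto simp: indicator_def)
      also have "\<dots> = g t - g a"
        using \<open>AC_on a b g\<close> t unfolding AC_on_def by (metis add_diff_cancel_left')
      finally show ?thesis .
    qed
  qed
  have Db: "(LINT s|lebesgue. D g s) = g b - g a" if "AC_on a b g" for g
  proof -
    have "(\<lambda>s. indicator {..b} s * D g s) = D g"
      by (auto simp: D_def indicator_def fun_eq_iff)
    then show ?thesis using D(2)[OF that, of b] ab by simp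
  qed
  obtain u where u: "integrable lborel u" "AE x in lborel. D g x = u x" "(LINT x|lebesgue. D g x) = (LINT x|lborel. u x)"
    using integrable_lebesgue_borel_version[OF D(1)[OF g]] .
  obtain v where v: "integrable lborel v" "AE x in lborel. D p x = v x" "(LINT x|lebesgue. D p x) = (LINT x|lborel. v x)"
    using integrable_lebesgue_borel_version[OF D(1)[OF p]] .
  have prim: "(LBINT s:{..t}. w s) = k t - k a"
    if k: "AC_on a b k" and w: "integrable lborel w" "AE x in lborel. D k x = w x" and t: "t \<in> {a..b}" for k w t
  proof -
    have "(LINT s|lebesgue. indicator {..t} s * D k s) = (LINT s|lborel. indicator {..t} s * w s)"
    proof (rule lebesgue_integral_borel_version(2))
      show "integrable lborel (\<lambda>s. indicator {..t} s * w s)"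
        using integrable_mult_indicator[OF _ w(1), of "{..t}"] by simp
      show "AE s in lborel. indicator {..t} s * D k s = indicator {..t} s * w s"
        using w(2) by eventually_elim simp
    qed
    then show ?thesis
      using D(2)[OF k t] by (simp add: set_lebesgue_integral_def)
  qed
  \<comment> \<open>Stated for arbitrary functions because it is used twice, with the roles of
    \<open>g\<close> and \<open>p\<close> exchanged.\<close>
  have *: "integrable lebesgue (\<lambda>t. D p t * (g t - g a))"
    "(LINT t|lebesgue. D p t * (g t - g a)) = (LBINT t. v t * (LBINT s:{..t}. u s))"
    if u: "AC_on a b g" "integrable lborel u" "AE x in lborel. D g x = u x"
      and v: "AC_on a b p" "integrable lborel v" "AE x in lborel. D p x = v x" for g p u v
  proof -
    \<comment> \<open>Outside \<open>{a..b}\<close> both sides vanish because there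
      \<open>v t = D p t = 0\<close>.\<close>
    have ae: "AE t in lborel. D p t * (g t - g a) = v t * (LBINT s:{..t}. u s)"
      using v(3)
    proof eventually_elim
      case (elim t)
      then show ?case
        using prim[OF u, of t] by (cases "t \<in> {a..b}") (auto simp: D_def)
    qed
    note lebesgue_integral_borel_version[OF integral_product_triangle(1)[OF u(2) v(2)] ae]
    then show "integrable lebesgue (\<lambda>t. D p t * (g t - g a))"
      "(LINT t|lebesgue. D p t * (g t - g a)) = (LBINT t. v t * (LBINT s:{..t}. u s))" by auto
  qed
  note 1 = *[OF g u(1,2) p v(1,2)] and 2 = *[OF p v(1,2) g u(1,2)]
  \<comment> \<open>Subtracting the values at \<open>a\<close> reduces the claim to primitives
    vanishing at \<open>a\<close>; the constants contribute the last two summands.\<close>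
  have "(LINT t:{a..b}|lebesgue. deriv g t * p t + g t * deriv p t)
     = (LINT t|lebesgue. D p t * (g t - g a) + D g t * (p t - p a) + g a * D p t + p a * D g t)"
    unfolding set_lebesgue_integral_def D_def by (intro Bochner_Integration.integral_cong refl) (simp add: algebra_simps)
  also have "\<dots> = (g b - g a) * (p b - p a) + g a * (p b - p a) + p a * (g b - g a)"
    using 1 2 D(1)[OF g] D(1)[OF p] Db[OF g] Db[OF p] u(3) v(3) integral_product_triangle(2)[OF u(1) v(1)]
    by simp
  also have "\<dots> = g b * p b - g a * p a"
    by (simp add: algebra_simps)
  finally show ?thesis .
qed

text \<open>Integration by parts on compact intervals exhausting the open one: the boundary terms
  tend to 0, and by \<open>int\<close> the integrals converge to the full integral.\<close>

lemma loc_AC_integral_derivative_mult_eq_0: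
  assumes lu: "l < u" and g: "loc_AC l u g" and p: "loc_AC l u p"
    and van: "vanishes_at_ends l u (\<lambda>x. g x * p x)"
    and int: "set_integrable lebesgue (einterval l u) (\<lambda>t. deriv g t * p t + g t * deriv p t)"
  shows "(LINT t:einterval l u|lebesgue. deriv g t * p t + g t * deriv p t) = 0"
proof -
  let ?F = "\<lambda>t. deriv g t * p t + g t * deriv p t"
  have van: "((\<lambda>x. g (real_of_ereal x) * p (real_of_ereal x)) \<longlongrightarrow> 0) (at_right l)"
    "((\<lambda>x. g (real_of_ereal x) * p (real_of_ereal x)) \<longlongrightarrow> 0) (at_left u)"
    using van by (simp_all add: vanishes_at_ends_def)
  obtain b a :: "nat \<Rightarrow> real" where ab: "einterval l u = (\<Union>i. {a i..b i})"
    "incseq b" "decseq a" "\<And>i. a i < b i" "\<And>i. l < a i" "\<And>i. b i < u"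
    "a \<longlonglongrightarrow> l" "b \<longlonglongrightarrow> u"
    by (rule einterval_Icc_approximation[OF lu]) blast
  have "(\<lambda>i. LINT t:{a i..b i}|lebesgue. ?F t) \<longlonglongrightarrow> (LINT t:(\<Union>i. {a i..b i})|lebesgue. ?F t)"
  proof (rule set_integral_cont_up)
    show "incseq (\<lambda>i. {a i..b i})"
      using ab(2,3) by (auto simp: incseq_def decseq_def intro: order_trans)
  qed (use int ab in auto)
  moreover have "(LINT t:{a i..b i}|lebesgue. ?F t) = g (b i) * p (b i) - g (a i) * p (a i)" for i
  proof -
    have "a i \<le> b i" "{a i..b i} \<subseteq> einterval l u"
      using ab by (auto intro: less_imp_le)
    then show ?thesis
      using g p unfolding loc_AC_def by (intro AC_on_integration_by_parts) auto
  qed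
  moreover have "(\<lambda>i. g (b i) * p (b i) - g (a i) * p (a i)) \<longlonglongrightarrow> 0 - 0"
  proof (rule tendsto_diff)
    have "filterlim (\<lambda>i. ereal (b i)) (at_left u) sequentially"
      using ab(6,8) by (auto simp: filterlim_at less_imp_neq)
    then show "(\<lambda>i. g (b i) * p (b i)) \<longlonglongrightarrow> 0"
      using filterlim_compose[OF van(2)] by fastforce
    have "filterlim (\<lambda>i. ereal (a i)) (at_right l) sequentially"
      using ab(5,7) by (auto simp: filterlim_at less_imp_neq[symmetric])
    then show "(\<lambda>i. g (a i) * p (a i)) \<longlonglongrightarrow> 0"
      using filterlim_compose[OF van(1)] by fastforce
  qed
  ultimately have "(LINT t:(\<Union>i. {a i..b i})|lebesgue. ?F t) = 0 - 0"
    by (simp add: LIMSEQ_unique)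
  then show ?thesis
    by (simp add: ab(1))
qed

subsection \<open>Lebesgue differentiation\<close>

lemma lebesgue_primitive_diff:
  fixes k :: "real \<Rightarrow> real"
  assumes k: "integrable lebesgue k" and "x \<le> y"
  shows "(LINT t:{..y}|lebesgue. k t) - (LINT t:{..x}|lebesgue. k t) = integral {x..y} k"
proof -
  have si: "set_integrable lebesgue S k" if "S \<in> sets lebesgue" for S
    using integrable_mult_indicator[OF that k] by (simp add: set_integrable_def)
  have "(LINT t:{..y}|lebesgue. k t) - (LINT t:{..x}|lebesgue. k t)
      = (LINT t|lebesgue. indicator {..y} t * k t - indicator {..x} t * k t)"
    using si[of "{..y}"] si[of "{..x}"] by (simp add: set_lebesgue_integral_def set_integrable_def)
  also have "\<dots> = (LINT t:{x..y}|lebesgue. k t)"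
    unfolding set_lebesgue_integral_def
  proof (rule integral_cong_AE)
    \<comment> \<open>The difference of the two half lines is open at \<open>x\<close>; this one
      point is a null set.\<close>
    show "AE t in lebesgue. indicator {..y} t * k t - indicator {..x} t * k t = indicator {x..y} t *\<^sub>R k t"
      using AE_completion[OF AE_lborel_singleton[of x]]
      by eventually_elim (use \<open>x \<le> y\<close> in \<open>auto simp: indicator_def\<close>)
  qed (use si[of "{..y}"] si[of "{..x}"] si[of "{x..y}"] in \<open>auto simp: set_integrable_def\<close>)
  also have "\<dots> = integral {x..y} k"
    by (rule set_lebesgue_integral_eq_integral(2)[OF si]) simp
  finally show ?thesis .
qed

lemma lebesgue_primitive_continuous_on:
  fixes k :: "real \<Rightarrow> real"
  assumes k: "integrable lebesgue k"
  shows "continuous_on S (\<lambda>y. LINT t:{..y}|lebesgue. k t)"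
proof -
  have k': "k integrable_on {a..b}" for a b
    using integrable_mult_indicator[OF _ k, of "{a..b}"]
    by (intro set_lebesgue_integral_eq_integral(1)) (simp add: set_integrable_def)
  have "isCont (\<lambda>y. LINT t:{..y}|lebesgue. k t) x" for x
  proof -
    have "continuous_on {x - 1..x + 1} (\<lambda>y. (LINT t:{..x - 1}|lebesgue. k t) + integral {x - 1..y} k)"
      by (intro continuous_intros indefinite_integral_continuous_1 k')
    moreover have "(LINT t:{..x - 1}|lebesgue. k t) + integral {x - 1..y} k = (LINT t:{..y}|lebesgue. k t)"
      if "y \<in> {x - 1..x + 1}" for y
      using lebesgue_primitive_diff[OF k, of "x - 1" y] that by simp
    ultimately have "continuous_on {x - 1..x + 1} (\<lambda>y. LINT t:{..y}|lebesgue. k t)"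
      by (metis (no_types, lifting) continuous_on_cong)
    then show ?thesis
      by (rule continuous_on_interior) simp
  qed
  then show ?thesis
    by (simp add: continuous_at_imp_continuous_on)
qed

text \<open>The library proposition \<open>integrable_ccontinuous_explicit\<close> yields one-sided derivatives; the
  left derivative comes from applying it to the reflected function.\<close>

lemma AE_lebesgue_primitive_has_derivative:
  fixes k :: "real \<Rightarrow> real"
  assumes k: "integrable lebesgue k"
  shows "AE x in lborel. ((\<lambda>y. LINT t:{..y}|lebesgue. k t) has_real_derivative k x) (at x)"
proof -
  let ?F = "\<lambda>y. LINT t:{..y}|lebesgue. k t"
  have k': "k integrable_on {a..b}" for a b
    using integrable_mult_indicator[OF _ k, of "{a..b}"]
    by (intro set_lebesgue_integral_eq_integral(1)) (simp add: set_integrable_def)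
  have k'': "(\<lambda>x. k (- x)) integrable_on {a..b}" for a b
    using k'[of "- b" "- a"] Henstock_Kurzweil_Integration.integrable_reflect_real[where f = k and a = "- b" and b = "- a"] by simp
  obtain N1 where N1: "negligible N1"
    "\<And>x e. x \<notin> N1 \<Longrightarrow> 0 < e \<Longrightarrow> \<exists>d>0. \<forall>h. 0 < h \<and> h < d \<longrightarrow> \<bar>integral {x..x + h} k / h - k x\<bar> < e"
  proof (rule integrable_ccontinuous_explicit[of k])
    show "k integrable_on cbox a b" for a b
      using k' by simp
  qed (use that in \<open>auto simp: divide_inverse mult.commute\<close>)
  obtain N2 where N2: "negligible N2"
    "\<And>x e. x \<notin> N2 \<Longrightarrow> 0 < e \<Longrightarrow> \<exists>d>0. \<forall>h. 0 < h \<and> h < d \<longrightarrow> \<bar>integral {x..x + h} (\<lambda>x. k (- x)) / h - k (- x)\<bar> < e"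
  proof (rule integrable_ccontinuous_explicit[of "\<lambda>x. k (- x)"])
    show "(\<lambda>x. k (- x)) integrable_on cbox a b" for a b
      using k'' by simp
  qed (use that in \<open>auto simp: divide_inverse mult.commute\<close>)
  \<comment> \<open>Reflection is differentiable and therefore preserves negligible sets.\<close>
  have "negligible (N1 \<union> uminus ` N2)"
    using N1(1) N2(1) by (intro negligible_Un negligible_differentiable_image_negligible) (auto intro!: derivative_intros)
  then have "AE x in lebesgue. x \<notin> N1 \<union> uminus ` N2"
    using AE_not_in negligible_iff_null_sets by blast
  then have "AE x in lborel. x \<notin> N1 \<union> uminus ` N2"
    by (simp add: AE_completion_iff)
  then show ?thesis
  proof eventually_elim
    case (elim x)
    have nx: "- x \<notin> N2" using elim by (metis UnI2 image_eqI minus_minus)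
    have "\<exists>d>0. \<forall>h. h \<noteq> 0 \<and> norm (h - 0) < d \<longrightarrow> norm ((?F (x + h) - ?F x) / h - k x) < e" if "e > 0" for e
    proof -
      obtain d1 where d1: "d1 > 0" "\<And>h. 0 < h \<Longrightarrow> h < d1 \<Longrightarrow> \<bar>integral {x..x + h} k / h - k x\<bar> < e"
        using N1(2)[of x e] elim \<open>e > 0\<close> by auto
      obtain d2 where d2: "d2 > 0" "\<And>h. 0 < h \<Longrightarrow> h < d2 \<Longrightarrow> \<bar>integral {- x..- x + h} (\<lambda>x. k (- x)) / h - k x\<bar> < e"
        using N2(2)[OF nx \<open>e > 0\<close>] by auto
      show ?thesis
      proof (intro exI[of _ "min d1 d2"] conjI allI impI)
        fix h :: real assume h: "h \<noteq> 0 \<and> norm (h - 0) < min d1 d2"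
        show "norm ((?F (x + h) - ?F x) / h - k x) < e"
        proof (cases "h > 0")
          case True
          then show ?thesis
            using h d1(2)[of h] lebesgue_primitive_diff[OF k, of x "x + h"] by simp
        next
          case False
          then have "?F x - ?F (x + h) = integral {x + h..x} k"
            using lebesgue_primitive_diff[OF k, of "x + h" x] by simp
          also have "\<dots> = integral {- x..- x + (- h)} (\<lambda>x. k (- x))"
            using Henstock_Kurzweil_Integration.integral_reflect_real[of x "x + h" k] by simp
          finally have "(?F (x + h) - ?F x) / h = integral {- x..- x + (- h)} (\<lambda>x. k (- x)) / (- h)"
            by (simp add: field_simps)
          then show ?thesis
            using False h d2(2)[of "- h"] by simp
        qed
      qed (use d1 d2 in auto)
    qed
    then show ?case
      unfolding DERIV_def LIM_def by (simp add: dist_norm)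
  qed
qed

text \<open>Integrability is assumed only up to interior points. Cutting \<open>k\<close> off at
  such a point \<open>d\<close> gives a function integrable on the whole line, whose primitive
  agrees with the interval integral to the left of \<open>d\<close>.\<close>

lemma interval_integral_primitive:
  fixes k :: "real \<Rightarrow> real"
  assumes k: "\<And>z. z \<in> einterval l u \<Longrightarrow> interval_lebesgue_integrable lebesgue l (ereal z) k"
  shows AE_interval_integral_has_derivative:
      "AE x in lborel. x \<in> einterval l u \<longrightarrow>
         ((\<lambda>y. LINT t=l..ereal y|lebesgue. k t) has_real_derivative k x) (at x)" (is ?ae)
    and interval_integral_continuous_on:
      "continuous_on (einterval l u) (\<lambda>y. LINT t=l..ereal y|lebesgue. k t)" (is ?cont)
proof -
  let ?I = "einterval l u" and ?F = "\<lambda>y. LINT t=l..ereal y|lebesgue. k t"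
  define K where "K = (\<lambda>d t. indicator (einterval l (ereal d)) t * k t)"
  have K: "integrable lebesgue (K d)" if "d \<in> ?I" for d
    using k[OF that] that
    by (auto simp: K_def interval_lebesgue_integrable_def set_integrable_def einterval_def split: if_splits)
  have eq: "(LINT t:{..y}|lebesgue. K d t) = ?F y" if "d \<in> ?I" "y \<in> ?I \<inter> {..<d}" for d y
  proof -
    have "(LINT t:{..y}|lebesgue. K d t) = (LINT t|lebesgue. indicator (einterval l (ereal y)) t *\<^sub>R k t)"
      unfolding set_lebesgue_integral_def
    proof (rule integral_cong_AE)
      show "AE t in lebesgue. indicator {..y} t *\<^sub>R K d t = indicator (einterval l (ereal y)) t *\<^sub>R k t"
        using AE_completion[OF AE_lborel_singleton[of y]]
        by eventually_elim (use that in \<open>auto simp: indicator_def K_def einterval_def\<close>)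
      show "(\<lambda>t. indicator {..y} t *\<^sub>R K d t) \<in> borel_measurable lebesgue"
        using integrable_mult_indicator[OF _ K[OF that(1)], of "{..y}"] by auto
      show "(\<lambda>t. indicator (einterval l (ereal y)) t *\<^sub>R k t) \<in> borel_measurable lebesgue"
        using K[of y] that by (auto simp: K_def)
    qed
    then show ?thesis
      using that by (auto simp: interval_lebesgue_integral_def set_lebesgue_integral_def einterval_def)
  qed
  have above: "\<exists>d. d \<in> ?I \<and> x < d" if "x \<in> ?I" for x
    by (rule einterval_subset_Icc[OF that]) (auto intro!: exI)
  have op: "open (?I \<inter> {..<d})" for d
    by (intro open_Int open_einterval open_lessThan)
  have "isCont ?F x" if x: "x \<in> ?I" for x
  proof -
    obtain d where d: "d \<in> ?I" "x < d" using above[OF x] by blast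
    have "continuous_on (?I \<inter> {..<d}) ?F"
      using lebesgue_primitive_continuous_on[OF K[OF d(1)]]
      by (rule continuous_on_eq) (rule eq[OF d(1)])
    then show ?thesis
      using x d op by (simp add: continuous_on_eq_continuous_at)
  qed
  then show ?cont
    by (simp add: continuous_at_imp_continuous_on)
  show ?ae
  proof (cases "l < u")
    case True
    obtain a b :: "nat \<Rightarrow> real" where ab: "\<And>i. l < a i" "\<And>i. b i < u" "\<And>i. a i < b i" "b \<longlonglongrightarrow> u"
      using einterval_Icc_approximation[OF True] by metis
    have bI: "b i \<in> ?I" for i
      using ab(1)[of i] ab(2)[of i] ab(3)[of i] by (auto simp: einterval_def intro: less_trans[of _ "ereal (a i)"])
    \<comment> \<open>Cutoffs \<open>b i\<close> tending to \<open>u\<close> cover every point of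
      the interval at the cost of countably many null sets.\<close>
    have "AE x in lborel. \<forall>i. ((\<lambda>y. LINT t:{..y}|lebesgue. K (b i) t) has_real_derivative K (b i) x) (at x)"
      unfolding AE_all_countable using AE_lebesgue_primitive_has_derivative[OF K[OF bI]] by blast
    then show ?thesis
    proof eventually_elim
      case (elim x)
      show ?case
      proof
        assume x: "x \<in> ?I"
        then have "ereal x < u" by (simp add: einterval_def)
        then obtain i where "ereal x < ereal (b i)"
          using order_tendstoD(1)[OF ab(4)] eventually_sequentially by (metis order_refl)
        then have i: "x < b i" by simp
        then have "K (b i) x = k x"
          using x by (auto simp: K_def einterval_def)
        then show "(?F has_real_derivative k x) (at x)"
          using elim[rule_format, of i] x i
          by (auto intro!: has_field_derivative_transform_within_open[OF _ op _ eq[OF bI]] simp: einterval_def)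
      qed
    qed
  next
    case False
    then have "einterval l u = {}"
      by (auto simp: einterval_def intro: less_trans)
    then show ?thesis by simp
  qed
qed

subsection \<open>Measurability of partial differentiability\<close>

lemma le_on_open_if_le_on_rationals:
  fixes f :: "real \<Rightarrow> real"
  assumes S: "open S" "continuous_on S f" and r: "\<And>r. real_of_rat r \<in> S \<Longrightarrow> f (real_of_rat r) \<le> c"
    and x: "x \<in> S"
  shows "f x \<le> c"
proof (rule ccontr)
  assume "\<not> f x \<le> c"
  then have "x \<in> S \<inter> f -` {c<..}" using x by simp
  moreover have "open (S \<inter> f -` {c<..})"
    by (intro continuous_open_preimage[OF S(2,1)] open_greaterThan)
  ultimately obtain d where d: "d > 0" "ball x d \<subseteq> S \<inter> f -` {c<..}"
    by (meson open_contains_ball)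
  obtain q where "x < real_of_rat q" "real_of_rat q < x + d"
    using of_rat_dense[of x "x + d"] d(1) by auto
  then have "real_of_rat q \<in> S \<inter> f -` {c<..}"
    using d(2) by (auto simp: subset_iff dist_real_def)
  then show False using r by force
qed

text \<open>The Cauchy criterion for difference quotients avoids the value of the derivative, and
  rational increments leave only countable quantifiers, as measurability requires. Continuity
  carries the non-strict bounds over to real increments.\<close>

lemma field_differentiable_iff_rational_Cauchy:
  fixes f :: "real \<Rightarrow> real" and x :: real
  defines "dq \<equiv> \<lambda>s. (f (x + s) - f x) / s"
  assumes "open S" "x \<in> S" "continuous_on S f"
  shows "f field_differentiable (at x) \<longleftrightarrow>
    (\<forall>n::nat. \<exists>m::nat. \<forall>s t::rat. s \<noteq> 0 \<longrightarrow> t \<noteq> 0 \<longrightarrow> \<bar>real_of_rat s\<bar> < inverse (Suc m) \<longrightarrow>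
        \<bar>real_of_rat t\<bar> < inverse (Suc m) \<longrightarrow>
        \<bar>dq (real_of_rat s) - dq (real_of_rat t)\<bar> \<le> inverse (Suc n))" (is "_ \<longleftrightarrow> ?R")
proof
  assume "f field_differentiable (at x)"
  then obtain D where D: "(dq \<longlongrightarrow> D) (at 0)"
    by (auto simp: field_differentiable_def DERIV_def dq_def)
  show ?R
  proof
    fix n :: nat
    have "0 < inverse (Suc n) / 2" by simp
    then obtain d where d: "d > 0" "\<And>s. s \<noteq> 0 \<Longrightarrow> \<bar>s\<bar> < d \<Longrightarrow> \<bar>dq s - D\<bar> < inverse (Suc n) / 2"
      using D unfolding LIM_def dist_real_def by (metis diff_zero)
    obtain m where m: "inverse (Suc m) < d"
      using reals_Archimedean[OF d(1)] by blast
    have "\<bar>dq s - dq t\<bar> \<le> inverse (Suc n)"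
      if "s \<noteq> 0" "t \<noteq> 0" "\<bar>s\<bar> < inverse (Suc m)" "\<bar>t\<bar> < inverse (Suc m)" for s t
      using d(2)[of s] d(2)[of t] that m by linarith
    then show "\<exists>m::nat. \<forall>s t::rat. s \<noteq> 0 \<longrightarrow> t \<noteq> 0 \<longrightarrow> \<bar>real_of_rat s\<bar> < inverse (Suc m) \<longrightarrow>
        \<bar>real_of_rat t\<bar> < inverse (Suc m) \<longrightarrow>
        \<bar>dq (real_of_rat s) - dq (real_of_rat t)\<bar> \<le> inverse (Suc n)"
      by (intro exI[of _ m]) simp
  qed
next
  assume R: ?R
  obtain e where e: "e > 0" "ball x e \<subseteq> S"
    using \<open>open S\<close> \<open>x \<in> S\<close> open_contains_ball by blast
  have "\<exists>P. eventually P (at 0) \<and> (\<forall>s t. P s \<and> P t \<longrightarrow> dist (dq s) (dq t) < \<epsilon>)" if eps: "\<epsilon> > 0" for \<epsilon>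
  proof -
    obtain n where n: "inverse (Suc n) < \<epsilon>"
      using reals_Archimedean[OF eps] by blast
    obtain m :: nat where m: "\<And>s t::rat. s \<noteq> 0 \<Longrightarrow> t \<noteq> 0 \<Longrightarrow> \<bar>real_of_rat s\<bar> < inverse (Suc m) \<Longrightarrow>
        \<bar>real_of_rat t\<bar> < inverse (Suc m) \<Longrightarrow>
        \<bar>dq (real_of_rat s) - dq (real_of_rat t)\<bar> \<le> inverse (Suc n)"
      using R by blast
    define d where "d = min e (inverse (Suc m))"
    have d0: "d > 0" using e by (simp add: d_def)
    \<comment> \<open>The ball is punctured because \<open>dq\<close> is continuous only away from
      the increment 0.\<close>
    define B where "B = ball 0 d - {0::real}"
    have B: "open B" by (simp add: B_def open_Diff)
    have cont: "continuous_on B dq"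
      unfolding dq_def
    proof (intro continuous_intros)
      show "continuous_on B (\<lambda>s. f (x + s))"
        by (rule continuous_on_compose2[OF \<open>continuous_on S f\<close>])
          (use e in \<open>auto intro!: continuous_intros simp: B_def d_def dist_real_def subset_iff\<close>)
    qed (auto simp: B_def)
    \<comment> \<open>Density is used in one increment at a time: first \<open>s\<close> becomes
      real while \<open>t\<close> stays rational, then \<open>t\<close> becomes real too.\<close>
    have 1: "\<bar>dq s - dq (real_of_rat t)\<bar> \<le> inverse (Suc n)" if "s \<in> B" "real_of_rat t \<in> B" for s t
    proof (rule le_on_open_if_le_on_rationals[OF B _ _ that(1)])
      show "continuous_on B (\<lambda>s. \<bar>dq s - dq (real_of_rat t)\<bar>)"
        by (intro continuous_intros cont)
      show "\<bar>dq (real_of_rat s) - dq (real_of_rat t)\<bar> \<le> inverse (Suc n)" if "real_of_rat s \<in> B" for s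
        using that \<open>real_of_rat t \<in> B\<close> by (intro m) (auto simp: B_def d_def)
    qed
    have 2: "\<bar>dq s - dq t\<bar> \<le> inverse (Suc n)" if "s \<in> B" "t \<in> B" for s t
    proof (rule le_on_open_if_le_on_rationals[OF B _ _ that(2)])
      show "continuous_on B (\<lambda>t. \<bar>dq s - dq t\<bar>)"
        by (intro continuous_intros cont)
    qed (use 1 that in auto)
    show ?thesis
    proof (intro exI[of _ "\<lambda>s. s \<in> B"] conjI allI impI)
      show "\<forall>\<^sub>F s in at 0. s \<in> B"
        unfolding eventually_at using d0 by (auto simp: B_def intro!: exI[of _ d])
      show "dist (dq s) (dq t) < \<epsilon>" if "s \<in> B \<and> t \<in> B" for s t
        using 2 that n by (fastforce simp: dist_real_def)
    qed
  qed
  then have "cauchy_filter (filtermap dq (at 0))"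
    by (simp add: cauchy_filter_metric_filtermap)
  moreover have "filtermap dq (at 0) \<noteq> bot"
    by (simp add: filtermap_bot_iff)
  ultimately obtain D where "filtermap dq (at 0) \<le> nhds D"
    using complete_UNIV unfolding complete_uniform by (metis principal_UNIV top_greatest)
  then show "f field_differentiable (at x)"
    by (auto simp: field_differentiable_def DERIV_def dq_def filterlim_def)
qed

text \<open>The rational Cauchy criterion describes the set by countably many conditions on Borel
  functions.\<close>

lemma sets_borel_partial_differentiable:
  fixes g :: "real \<times> real \<Rightarrow> real"
  assumes "open R" "continuous_on R g"
  shows "{z \<in> R. (\<lambda>x. g (x, snd z)) field_differentiable (at (fst z))} \<in> sets borel"
proof -
  \<comment> \<open>Extension by 0 gives a Borel function on the whole plane. Since \<open>R\<close>
    is open, it equals \<open>g\<close> near each point of \<open>R\<close>, so differentiability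
    there is unaffected.\<close>
  define G where "G = (\<lambda>z. indicator R z *\<^sub>R g z)"
  have G[measurable]: "G \<in> borel_measurable borel"
    unfolding G_def by (rule borel_measurable_continuous_on_indicator) (use assms in auto)
  define dq where "dq = (\<lambda>s z. (G (fst z + s, snd z) - G z) / s)"
  have [measurable]: "R \<in> sets borel" using assms(1) by auto
  have [measurable]: "dq s \<in> borel_measurable borel" for s
  proof -
    have "(\<lambda>z. (fst z + s, snd z)) \<in> borel_measurable (borel :: (real \<times> real) measure)"
      by (intro borel_measurable_continuous_onI continuous_intros)
    from measurable_compose[OF this G] show ?thesis
      unfolding dq_def by measurable
  qed
  define P where "P = (\<lambda>z. \<forall>n::nat. \<exists>m::nat. \<forall>s t::rat. s \<noteq> 0 \<longrightarrow> t \<noteq> 0 \<longrightarrow> \<bar>real_of_rat s\<bar> < inverse (Suc m) \<longrightarrow>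
        \<bar>real_of_rat t\<bar> < inverse (Suc m) \<longrightarrow>
        \<bar>dq (real_of_rat s) z - dq (real_of_rat t) z\<bar> \<le> inverse (Suc n))"
  have "{z \<in> R. (\<lambda>x. g (x, snd z)) field_differentiable (at (fst z))} = {z \<in> R. P z}"
  proof (rule Collect_cong, rule conj_cong[OF refl])
    fix z assume z: "z \<in> R"
    let ?S = "(\<lambda>x. (x, snd z)) -` R"
    have S: "open ?S" "fst z \<in> ?S"
      using assms(1) z by (auto intro!: continuous_open_vimage continuous_intros)
    have "continuous_on ?S (\<lambda>x. g (x, snd z))"
      by (rule continuous_on_compose2[OF assms(2)]) (auto intro!: continuous_intros)
    moreover have Gg: "G (x, snd z) = g (x, snd z)" if "x \<in> ?S" for x
      using that by (simp add: G_def)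
    ultimately have cont: "continuous_on ?S (\<lambda>x. G (x, snd z))"
      using continuous_on_cong[of ?S ?S "\<lambda>x. G (x, snd z)" "\<lambda>x. g (x, snd z)"] by simp
    have "(\<lambda>x. g (x, snd z)) field_differentiable (at (fst z)) \<longleftrightarrow> (\<lambda>x. G (x, snd z)) field_differentiable (at (fst z))"
      unfolding field_differentiable_def
      using has_field_derivative_transform_within_open[OF _ S, of _ _ "\<lambda>x. g (x, snd z)"]
        has_field_derivative_transform_within_open[OF _ S, of _ _ "\<lambda>x. G (x, snd z)"] Gg
      by metis
    also have "\<dots> \<longleftrightarrow> P z"
      using field_differentiable_iff_rational_Cauchy[OF S cont]
      by (simp add: P_def dq_def)
    finally show "(\<lambda>x. g (x, snd z)) field_differentiable (at (fst z)) \<longleftrightarrow> P z" .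
  qed
  also have "\<dots> \<in> sets borel"
  proof -
    have "{z \<in> space borel. z \<in> R \<and> P z} \<in> sets borel"
      unfolding P_def by measurable
    then show ?thesis by simp
  qed
  finally show ?thesis .
qed

text \<open>Exchanging the order of the two almost-everywhere quantifiers needs the exceptional set to be
  measurable in the plane.\<close>

lemma AE_partial_differentiable:
  fixes g :: "real \<times> real \<Rightarrow> real"
  assumes R: "open R" "continuous_on R g"
    and ae: "AE y in lborel. AE x in lborel. (x, y) \<in> R \<longrightarrow> (\<lambda>x. g (x, y)) field_differentiable (at x)"
  shows "AE x in lborel. AE y in lborel. (x, y) \<in> R \<longrightarrow> (\<lambda>x. g (x, y)) field_differentiable (at x)"
proof -
  let ?D = "{z \<in> R. (\<lambda>x. g (x, snd z)) field_differentiable (at (fst z))}"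
  have "- R \<union> ?D \<in> sets borel"
    using sets_borel_partial_differentiable[OF R] R(1) by auto
  moreover have "{z \<in> space (lborel \<Otimes>\<^sub>M lborel). (fst z, snd z) \<in> R \<longrightarrow> (\<lambda>x. g (x, snd z)) field_differentiable (at (fst z))}
      = - R \<union> ?D"
    by (auto simp: space_pair_measure)
  ultimately have "{z \<in> space (lborel \<Otimes>\<^sub>M lborel). (fst z, snd z) \<in> R \<longrightarrow> (\<lambda>x. g (x, snd z)) field_differentiable (at (fst z))}
      \<in> sets (lborel \<Otimes>\<^sub>M lborel)"
    unfolding lborel_prod by simp
  from lborel_pair.AE_commute[OF this] ae show ?thesis
    by blast
qed

subsection \<open>Integration by parts for the standardization function\<close>

text \<open>Differentiability of \<open>F\<close> at \<open>x\<close> is derived: near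
  \<open>x\<close>, \<open>F\<close> is the quotient of \<open>\<Phi>\<close> by the nonvanishing
  \<open>p\<close>. The product rule then computes the derivative of \<open>\<Phi>\<close> in a
  second way.\<close>

lemma deriv_mult_eq_if_mult_eq_on_open:
  fixes F p \<Phi> :: "real \<Rightarrow> real"
  assumes S: "open S" "x \<in> S" and eq: "\<And>y. y \<in> S \<Longrightarrow> F y * p y = \<Phi> y" and nz: "\<And>y. y \<in> S \<Longrightarrow> p y \<noteq> 0"
    and p: "p field_differentiable (at x)" and \<Phi>: "(\<Phi> has_real_derivative D) (at x)"
  shows "deriv F x * p x + F x * deriv p x = D"
proof -
  have p': "(p has_real_derivative deriv p x) (at x)"
    using p by (simp add: DERIV_deriv_iff_field_differentiable)
  have "((\<lambda>y. \<Phi> y / p y) has_real_derivative (D * p x - \<Phi> x * deriv p x) / (p x * p x)) (at x)"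
    by (rule DERIV_divide[OF \<Phi> p' nz[OF S(2)]])
  then have "(F has_real_derivative (D * p x - \<Phi> x * deriv p x) / (p x * p x)) (at x)"
    by (rule has_field_derivative_transform_within_open[OF _ S]) (simp add: eq[symmetric] nz)
  then have F': "(F has_real_derivative deriv F x) (at x)"
    using DERIV_imp_deriv by fastforce
  have "((\<lambda>y. F y * p y) has_real_derivative D) (at x)"
    by (rule has_field_derivative_transform_within_open[OF \<Phi> S]) (simp add: eq)
  moreover have "((\<lambda>y. F y * p y) has_real_derivative deriv F x * p x + F x * deriv p x) (at x)"
    using DERIV_mult[OF F' p'] by (simp add: mult.commute)
  ultimately show ?thesis
    using DERIV_unique by blast
qed

text \<open>The set where the functions differ is open by continuity and negligible, hence
  empty.\<close>

lemma AE_eq_continuous_on_open: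
  fixes f g :: "real \<Rightarrow> real"
  assumes S: "open S" and f: "continuous_on S f" and g: "continuous_on S g"
    and ae: "AE x in lborel. x \<in> S \<longrightarrow> f x = g x" and x: "x \<in> S"
  shows "f x = g x"
proof -
  have "open (S \<inter> (\<lambda>x. f x - g x) -` (- {0}))"
    by (intro continuous_open_preimage S continuous_intros f g)
  moreover have "negligible (S \<inter> (\<lambda>x. f x - g x) -` (- {0}))"
  proof -
    have "AE x in lebesgue. x \<notin> S \<inter> (\<lambda>x. f x - g x) -` (- {0})"
      using ae by (auto intro!: AE_completion elim: eventually_mono)
    moreover have "S \<inter> (\<lambda>x. f x - g x) -` (- {0}) = {x \<in> S. f x \<noteq> g x}"
      by auto
    ultimately show ?thesis
      by (simp add: negligible_iff_null_sets completion.AE_iff_null_sets)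
  qed
  ultimately have "S \<inter> (\<lambda>x. f x - g x) -` (- {0}) = {}"
    using open_not_negligible by blast
  then show ?thesis using x by auto
qed

text \<open>A property that holds almost everywhere holds somewhere in each interval of positive
  length. This extends integrability up to almost every endpoint to all endpoints, as a good
  endpoint lies further right.\<close>

lemma exists_between_if_AE:
  assumes "AE x in lborel. x \<in> einterval l u \<longrightarrow> P x" and z: "z \<in> einterval l u"
  shows "\<exists>x\<in>einterval l u. z < x \<and> P x"
proof -
  obtain a b where ab: "a < z" "z < b" "{a..b} \<subseteq> einterval l u"
    using einterval_subset_Icc[OF z] by blast
  have "\<not> (AE x in lborel. x \<notin> {z<..<b})"
  proof
    assume "AE x in lborel. x \<notin> {z<..<b}"
    then have "emeasure lborel {z<..<b} = 0"
      by (subst (asm) AE_iff_measurable[where N = "{z<..<b}"]) auto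
    then show False using ab by simp
  qed
  then obtain x where x: "x \<in> {z<..<b}" "x \<in> einterval l u \<longrightarrow> P x"
    using assms(1) by (smt (verit) eventually_mono)
  then have "x \<in> einterval l u"
    using ab(1) by (intro subsetD[OF ab(3)]) auto
  then show ?thesis
    using x by auto
qed

lemma interval_lebesgue_integrable_mono:
  assumes "interval_lebesgue_integrable lebesgue l (ereal y) k" "l \<le> ereal x" "x \<le> y"
  shows "interval_lebesgue_integrable lebesgue l (ereal x) k"
proof -
  have "set_integrable lebesgue (einterval l (ereal y)) k"
    using assms order_trans[of l "ereal x" "ereal y"] by (simp add: interval_lebesgue_integrable_def)
  then have "set_integrable lebesgue (einterval l (ereal x)) k"
    by (rule set_integrable_subset) (use assms(3) in \<open>auto simp: einterval_def\<close>)
  then show ?thesis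
    using assms(2) by (simp add: interval_lebesgue_integrable_def)
qed

text \<open>Turns expectations into Lebesgue integrals over the whole plane, the form to which the
  Fubini lemmas apply.\<close>

lemma integral_dens_measure:
  assumes R: "open R" and p: "continuous_on R p" "\<And>z. z \<in> R \<Longrightarrow> 0 \<le> p z"
    and \<phi>: "integrable (dens_measure R p) \<phi>"
  shows "integrable lebesgue (\<lambda>z. indicator R z * (p z * \<phi> z))"
    and "(LINT z|dens_measure R p. \<phi> z) = (LINT z|lebesgue. indicator R z * (p z * \<phi> z))"
proof -
  have Rl: "R \<in> sets lebesgue" using R by auto
  have pm: "p \<in> borel_measurable (lebesgue_on R)"
    by (rule continuous_imp_measurable_on_sets_lebesgue[OF p(1) Rl])
  have \<phi>m: "\<phi> \<in> borel_measurable (lebesgue_on R)"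
    using borel_measurable_integrable[OF \<phi>] by (simp add: dens_measure_def)
  have nn: "AE z in lebesgue_on R. 0 \<le> p z"
    by (rule AE_I2) (use p(2) in simp)
  show "integrable lebesgue (\<lambda>z. indicator R z * (p z * \<phi> z))"
    using \<phi> Rl unfolding dens_measure_def integrable_density[OF \<phi>m pm nn]
    by (simp add: integrable_restrict_space)
  show "(LINT z|dens_measure R p. \<phi> z) = (LINT z|lebesgue. indicator R z * (p z * \<phi> z))"
    using Rl unfolding dens_measure_def integral_density[OF \<phi>m pm nn]
    by (simp add: integral_restrict_space)
qed

lemma param_deriv_eq: "has_param_deriv i F D \<theta> \<Longrightarrow> param_deriv i F \<theta> = D"
  by (simp add: has_param_deriv_def param_deriv_def DERIV_imp_deriv)

lemma has_param_deriv_if_differentiable_on: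
  fixes F :: "real ^ 'n \<Rightarrow> real"
  assumes "F differentiable_on \<Theta>" "open \<Theta>" "\<theta> \<in> \<Theta>"
  shows "has_param_deriv i F (param_deriv i F \<theta>) \<theta>"
proof -
  have "F differentiable (at (\<theta> + 0 *\<^sub>R axis i 1))"
    using assms by (simp add: differentiable_on_eq_differentiable_at)
  moreover have "(\<lambda>s. \<theta> + s *\<^sub>R axis i 1) differentiable (at (0::real))"
    by (auto intro!: derivative_intros)
  ultimately have "(F \<circ> (\<lambda>s. \<theta> + s *\<^sub>R axis i 1)) differentiable (at 0)"
    by (intro differentiable_chain_at) auto
  then have "(\<lambda>s. F (\<theta> + s *\<^sub>R axis i 1)) field_differentiable (at 0)"
    by (simp add: comp_def field_differentiable_def real_differentiable_def)
  then show ?thesis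
    by (simp add: has_param_deriv_def param_deriv_def DERIV_deriv_iff_field_differentiable)
qed

lemma param_deriv_mult:
  assumes "has_param_deriv i F D \<theta>" "has_param_deriv i G E \<theta>"
  shows "param_deriv i (\<lambda>\<eta>. F \<eta> * G \<eta>) \<theta> = D * G \<theta> + F \<theta> * E"
proof (rule param_deriv_eq)
  show "has_param_deriv i (\<lambda>\<eta>. F \<eta> * G \<eta>) (D * G \<theta> + F \<theta> * E) \<theta>"
    using DERIV_mult[OF assms[unfolded has_param_deriv_def]]
    by (simp add: has_param_deriv_def algebra_simps)
qed

text \<open>The matrix is lower triangular, so forward substitution solves the system. Checking the
  solution \<open>?x\<close> and applying a left inverse avoids computing the inverse
  matrix.\<close>

lemma f_imp_eq:
  fixes q1 :: "real ^ 'n::finite \<Rightarrow> real \<Rightarrow> real" and z :: "real \<times> real" and i :: 'n and l1 :: ereal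
  assumes "q1 \<theta> (fst z) \<noteq> 0" "q2 \<theta> (fst z) (snd z) \<noteq> 0"
  defines "f1 \<equiv> param_deriv i (psi1 l1 q1 (fst z)) \<theta> / q1 \<theta> (fst z)"
  shows "f_imp l1 l2 q1 q2 \<theta> i 1 z = f1"
    and "f_imp l1 l2 q1 q2 \<theta> i 2 z =
      (param_deriv i (psi2 l2 q2 (fst z) (snd z)) \<theta>
        - z_deriv 1 (\<lambda>w. psi2 l2 q2 (fst w) (snd w) \<theta>) z * f1) / q2 \<theta> (fst z) (snd z)" (is "_ = ?f2")
proof -
  let ?A = "z_grad_Psi l2 q1 q2 \<theta> z"
  let ?x = "vector [f1, ?f2] :: real ^ 2"
  have "det ?A \<noteq> 0"
    using assms(1,2) by (simp add: det_2 z_grad_Psi_def)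
  \<comment> \<open>\<open>matrix_inv\<close> is a choice operator; the nonzero determinant
    guarantees that an inverse exists to be chosen.\<close>
  then have inv: "matrix_inv ?A ** ?A = mat 1"
    using someI_ex[of "\<lambda>B. ?A ** B = mat 1 \<and> B ** ?A = mat 1"]
    by (simp add: invertible_det_nz[symmetric] invertible_def matrix_inv_def)
  have Ax: "?A *v ?x = param_grad_Psi l1 l2 q1 q2 \<theta> i z"
    using assms(1,2)
    by (simp add: vec_eq_iff forall_2 matrix_vector_mult_def sum_2 z_grad_Psi_def param_grad_Psi_def f1_def)
  then have "matrix_inv ?A *v param_grad_Psi l1 l2 q1 q2 \<theta> i z = ?x"
    unfolding Ax[symmetric] by (simp add: matrix_vector_mul_assoc inv)
  then show "f_imp l1 l2 q1 q2 \<theta> i 1 z = f1" "f_imp l1 l2 q1 q2 \<theta> i 2 z = ?f2"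
    by (simp_all add: f_imp_def inner_axis')
qed

theorem theorem8:
  fixes l1 u1 l2 u2 :: ereal
    and \<Theta> :: "(real ^ 'n) set" and \<theta> :: "real ^ 'n" and i :: 'n
    and h1 :: "real \<Rightarrow> real" and T1 :: "real \<Rightarrow> real ^ 'k1"
    and \<phi>1 :: "real ^ 'n \<Rightarrow> real ^ 'k1" and A1 :: "real ^ 'n \<Rightarrow> real"
    and h2 :: "real \<Rightarrow> real \<Rightarrow> real" and T2 :: "real \<Rightarrow> real \<Rightarrow> real ^ 'k2"
    and \<phi>2 :: "real ^ 'n \<Rightarrow> real ^ 'k2" and A2 :: "real ^ 'n \<Rightarrow> real \<Rightarrow> real"
    and q1 :: "real ^ 'n \<Rightarrow> real \<Rightarrow> real" and q2 :: "real ^ 'n \<Rightarrow> real \<Rightarrow> real \<Rightarrow> real"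
    and h :: "real \<times> real \<Rightarrow> real"
  defines "I1 \<equiv> einterval l1 u1" and "I2 \<equiv> einterval l2 u2" and "R \<equiv> box2 l1 u1 l2 u2"
    and "q \<equiv> joint q1 q2"
    and "Q \<equiv> \<lambda>\<eta>. dens_measure (box2 l1 u1 l2 u2) (joint q1 q2 \<eta>)"
    and "f \<equiv> f_imp l1 l2 q1 q2 \<theta> i"
    and "ft1 \<equiv> \<lambda>z. f_imp l1 l2 q1 q2 \<theta> i 1 z * h z * q2 \<theta> (fst z) (snd z)"
    and "ft2 \<equiv> \<lambda>z. f_imp l1 l2 q1 q2 \<theta> i 2 z * h z"
  assumes lu: "l1 < u1" "l2 < u2"
    and \<Theta>: "open \<Theta>" "\<theta> \<in> \<Theta>"
    and q1_form: "\<And>\<eta> z1. \<eta> \<in> \<Theta> \<Longrightarrow> z1 \<in> I1 \<Longrightarrow>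
          q1 \<eta> z1 = h1 z1 * exp (T1 z1 \<bullet> \<phi>1 \<eta> - A1 \<eta>)"
    and q2_form: "\<And>\<eta> z1 z2. \<eta> \<in> \<Theta> \<Longrightarrow> z1 \<in> I1 \<Longrightarrow> z2 \<in> I2 \<Longrightarrow>
          q2 \<eta> z1 z2 = h2 z2 z1 * exp (T2 z2 z1 \<bullet> \<phi>2 \<eta> - A2 \<eta> z1)"
    and q1_dens: "\<And>\<eta>. \<eta> \<in> \<Theta> \<Longrightarrow> positive_density l1 u1 (q1 \<eta>)"
    and q2_dens: "\<And>\<eta> z1. \<eta> \<in> \<Theta> \<Longrightarrow> z1 \<in> I1 \<Longrightarrow> positive_density l2 u2 (q2 \<eta> z1)"
    and q1_diff: "\<And>z1. z1 \<in> I1 \<Longrightarrow> (\<lambda>\<eta>. q1 \<eta> z1) differentiable_on \<Theta>"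
    and q2_diff: "\<And>z1 z2. z1 \<in> I1 \<Longrightarrow> z2 \<in> I2 \<Longrightarrow> (\<lambda>\<eta>. q2 \<eta> z1 z2) differentiable_on \<Theta>"
    and q1_AC: "\<And>\<eta>. \<eta> \<in> \<Theta> \<Longrightarrow> loc_AC l1 u1 (q1 \<eta>)"
    and q2_ACL: "\<And>\<eta>. \<eta> \<in> \<Theta> \<Longrightarrow> loc_ACL l1 u1 l2 u2 (\<lambda>z. q2 \<eta> (fst z) (snd z))"
    and q_cont: "\<And>\<eta>. \<eta> \<in> \<Theta> \<Longrightarrow> continuous_on R (q \<eta>)"
    and h_ACL: "loc_ACL l1 u1 l2 u2 h"
    and h_cont: "continuous_on R h"
    and ft1_AC: "AE z2 in lebesgue_on I2. loc_AC l1 u1 (\<lambda>z1. ft1 (z1, z2)) \<and>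
          vanishes_at_ends l1 u1 (\<lambda>z1. ft1 (z1, z2) * q1 \<theta> z1)"
    and ft2_AC: "AE z1 in lebesgue_on I1. loc_AC l2 u2 (\<lambda>z2. ft2 (z1, z2)) \<and>
          vanishes_at_ends l2 u2 (\<lambda>z2. ft2 (z1, z2) * q2 \<theta> z1 z2)"
    and int1: "set_integrable lebesgue R (\<lambda>z. z_deriv 1 ft1 z * q1 \<theta> (fst z))"
    and int2: "set_integrable lebesgue R (\<lambda>z. ft1 z * deriv (q1 \<theta>) (fst z))"
    and int3: "integrable (Q \<theta>) (z_deriv 2 ft2)"
    and int4: "integrable (Q \<theta>)
          (\<lambda>z. ft2 z * (z_deriv 2 (\<lambda>w. q2 \<theta> (fst w) (snd w)) z / q2 \<theta> (fst z) (snd z)))"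
    and int5: "integrable (Q \<theta>) h"
    and int6: "integrable (Q \<theta>) (\<lambda>z. h z * (param_deriv i (\<lambda>\<eta>. q \<eta> z) \<theta> / q \<theta> z))"
    and int7: "integrable (Q \<theta>) (\<lambda>z. \<Sum>j\<in>UNIV. f j z * z_deriv j h z)"
    and swap_E: "has_param_deriv i (\<lambda>\<eta>. LINT z|Q \<eta>. h z)
          (LINT z|Q \<theta>. (h z * (param_deriv i (\<lambda>\<eta>. q \<eta> z) \<theta> / q \<theta> z))) \<theta>"
    and swap_psi1: "\<And>z1. z1 \<in> I1 \<Longrightarrow>
          interval_lebesgue_integrable lebesgue l1 (ereal z1) (\<lambda>t. param_deriv i (\<lambda>\<eta>. q1 \<eta> t) \<theta>) \<and>
          has_param_deriv i (psi1 l1 q1 z1)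
            (LINT t=l1..ereal z1|lebesgue. param_deriv i (\<lambda>\<eta>. q1 \<eta> t) \<theta>) \<theta>"
    and swap_psi2: "\<And>z1 z2. z1 \<in> I1 \<Longrightarrow> z2 \<in> I2 \<Longrightarrow>
          interval_lebesgue_integrable lebesgue l2 (ereal z2) (\<lambda>t. param_deriv i (\<lambda>\<eta>. q2 \<eta> z1 t) \<theta>) \<and>
          has_param_deriv i (psi2 l2 q2 z1 z2)
            (LINT t=l2..ereal z2|lebesgue. param_deriv i (\<lambda>\<eta>. q2 \<eta> z1 t) \<theta>) \<theta>"
    and swap_psi2_z1: "AE z in lebesgue_on R.
          interval_lebesgue_integrable lebesgue l2 (ereal (snd z)) (\<lambda>t. deriv (\<lambda>x. q2 \<theta> x t) (fst z)) \<and>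
          ((\<lambda>x. psi2 l2 q2 x (snd z) \<theta>) has_real_derivative
            (LINT t=l2..ereal (snd z)|lebesgue. deriv (\<lambda>x. q2 \<theta> x t) (fst z))) (at (fst z))"
  shows "has_param_deriv i (\<lambda>\<eta>. LINT z|Q \<eta>. h z)
           (- (LINT z|Q \<theta>. (\<Sum>j\<in>UNIV. f j z * z_deriv j h z))) \<theta>"
proof -
  \<comment> \<open>\<open>a\<close> and \<open>b\<close> are the parameter derivatives of \<open>\<psi>\<^sub>1\<close>, \<open>\<psi>\<^sub>2\<close>, and \<open>c\<close> is the \<open>z\<^sub>1\<close>-derivative of \<open>\<psi>\<^sub>2\<close>.\<close>
  let ?p = "q1 \<theta>" and ?r = "q2 \<theta>"
  let ?r2 = "\<lambda>w. q2 \<theta> (fst w) (snd w)"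
  define a where "a = (\<lambda>x. LINT t=l1..ereal x|lebesgue. param_deriv i (\<lambda>\<eta>. q1 \<eta> t) \<theta>)"
  define b where "b = (\<lambda>x y. LINT t=l2..ereal y|lebesgue. param_deriv i (\<lambda>\<eta>. q2 \<eta> x t) \<theta>)"
  define c where "c = (\<lambda>x y. z_deriv 1 (\<lambda>w. psi2 l2 q2 (fst w) (snd w) \<theta>) (x, y))"
  define C where "C = (\<lambda>x y. LINT t=l2..ereal y|lebesgue. deriv (\<lambda>x. q2 \<theta> x t) x)"

  \<comment> \<open>Positivity, continuity and explicit formulas on the box\<close>
  have R: "open R" "\<And>x y. (x, y) \<in> R \<longleftrightarrow> x \<in> I1 \<and> y \<in> I2"
    by (auto simp: R_def I1_def I2_def box2_def open_Times)
  have opI: "open I1" "open I2"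
    by (auto simp: I1_def I2_def)
  have ppos: "0 < ?p x" if "x \<in> I1" for x
    using q1_dens[OF \<Theta>(2)] that by (auto simp: positive_density_def I1_def)
  have rpos: "0 < ?r x y" if "x \<in> I1" "y \<in> I2" for x y
    using q2_dens[OF \<Theta>(2) that(1)] that(2) by (auto simp: positive_density_def I2_def)
  have qeq: "q \<theta> (x, y) = ?p x * ?r x y" for x y
    by (simp add: q_def joint_def)
  \<comment> \<open>Joint continuity is assumed for \<open>q\<close> only; dividing by the positive
    \<open>q1\<close>, continuous because it is locally AC, transfers it to
    \<open>q2\<close>.\<close>
  have r_cont: "continuous_on R ?r2"
  proof -
    have "continuous_on R (\<lambda>z. ?p (fst z))"
      by (rule continuous_on_compose2[OF loc_AC_continuous_on[OF q1_AC[OF \<Theta>(2)]]])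
        (auto simp: R_def box2_def intro!: continuous_intros)
    then have "continuous_on R (\<lambda>z. q \<theta> z / ?p (fst z))"
      using ppos R(2) by (intro continuous_on_divide q_cont[OF \<Theta>(2)]) (auto, force)
    then show ?thesis
      by (rule continuous_on_eq) (use ppos R(2) in \<open>auto simp: q_def joint_def, force\<close>)
  qed
  have f: "f 1 (x, y) = a x / ?p x" "f 2 (x, y) = (b x y - c x y * (a x / ?p x)) / ?r x y"
    if "x \<in> I1" "y \<in> I2" for x y
  proof -
    have nz: "?p (fst (x, y)) \<noteq> 0" "?r (fst (x, y)) (snd (x, y)) \<noteq> 0"
      using ppos rpos that by force+
    have ab: "param_deriv i (psi1 l1 q1 x) \<theta> = a x" "param_deriv i (psi2 l2 q2 x y) \<theta> = b x y"
      using param_deriv_eq swap_psi1 swap_psi2 that unfolding a_def b_def by blast+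
    show "f 1 (x, y) = a x / ?p x" "f 2 (x, y) = (b x y - c x y * (a x / ?p x)) / ?r x y"
      unfolding f_def f_imp_eq[of q1 \<theta> "(x, y)" q2, OF nz] by (simp_all add: ab c_def)
  qed
  have dq: "param_deriv i (\<lambda>\<eta>. q \<eta> (x, y)) \<theta>
      = param_deriv i (\<lambda>\<eta>. q1 \<eta> x) \<theta> * ?r x y + ?p x * param_deriv i (\<lambda>\<eta>. q2 \<eta> x y) \<theta>"
    if "x \<in> I1" "y \<in> I2" for x y
    unfolding q_def joint_def fst_conv snd_conv using that
    by (intro param_deriv_mult has_param_deriv_if_differentiable_on[OF _ \<Theta>] q1_diff q2_diff)

  \<comment> \<open>Almost-everywhere statements for fixed first coordinate\<close>
  have ae_lebesgue_on: "AE x in lborel. x \<in> einterval l u \<longrightarrow> P x" if "AE x in lebesgue_on (einterval l u). P x"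
    for l u and P :: "real \<Rightarrow> bool"
    using that by (simp add: AE_restrict_space_iff AE_completion_iff)

  \<comment> \<open>Local ACL regularity gives differentiability in \<open>x\<close> for almost
    every fixed \<open>y\<close>; the combined identity fixes \<open>x\<close> first, so the
    quantifiers are exchanged.\<close>
  have ae_d1: "AE x in lborel. AE y in lborel. (x, y) \<in> R \<longrightarrow> (\<lambda>x. g (x, y)) field_differentiable (at x)"
    if g: "loc_ACL l1 u1 l2 u2 g" "continuous_on R g" for g
  proof (rule AE_partial_differentiable[OF R(1) g(2)])
    have "AE y in lborel. y \<in> I2 \<longrightarrow> loc_AC l1 u1 (\<lambda>x. g (x, y))"
      using g(1) ae_lebesgue_on by (simp add: loc_ACL_def I2_def)
    then show "AE y in lborel. AE x in lborel. (x, y) \<in> R \<longrightarrow> (\<lambda>x. g (x, y)) field_differentiable (at x)"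
    proof eventually_elim
      case (elim y)
      show ?case
      proof (cases "y \<in> I2")
        case True
        then show ?thesis
          using loc_AC_AE_differentiable[of l1 u1 "\<lambda>x. g (x, y)"] elim
          by (auto simp: R(2) I1_def elim: eventually_mono)
      qed (simp add: R(2))
    qed
  qed
  have ae_AC2: "AE x in lborel. x \<in> I1 \<longrightarrow> loc_AC l2 u2 (\<lambda>y. g (x, y))" if "loc_ACL l1 u1 l2 u2 g" for g
    using that ae_lebesgue_on by (simp add: loc_ACL_def I1_def)
  have ae_c: "AE x in lborel. AE y in lborel. x \<in> I1 \<longrightarrow> y \<in> I2 \<longrightarrow>
      interval_lebesgue_integrable lebesgue l2 (ereal y) (\<lambda>t. deriv (\<lambda>x. q2 \<theta> x t) x) \<and> c x y = C x y"
  proof -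
    have "AE z in lebesgue. z \<in> R \<longrightarrow>
      interval_lebesgue_integrable lebesgue l2 (ereal (snd z)) (\<lambda>t. deriv (\<lambda>x. q2 \<theta> x t) (fst z)) \<and>
      c (fst z) (snd z) = C (fst z) (snd z)"
    proof -
      have "R \<inter> space lebesgue \<in> sets lebesgue" using R(1) by auto
      from swap_psi2_z1[unfolded AE_restrict_space_iff[OF this]] show ?thesis
        by eventually_elim (simp add: c_def C_def z_deriv_def DERIV_imp_deriv)
    qed
    from lborel_AE_Pair(1)[OF this] show ?thesis
      by eventually_elim (auto simp: R(2) elim!: eventually_mono)
  qed

  \<comment> \<open>Integrands from integration by parts and from the two expectations\<close>
  define F1 where "F1 = (\<lambda>z. z_deriv 1 ft1 z * ?p (fst z) + ft1 z * deriv ?p (fst z))"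
  define F2 where "F2 = (\<lambda>z. q \<theta> z * z_deriv 2 ft2 z + q \<theta> z * (ft2 z * (z_deriv 2 ?r2 z / ?r2 z)))"
  define G1 where "G1 = (\<lambda>z. q \<theta> z * (h z * (param_deriv i (\<lambda>\<eta>. q \<eta> z) \<theta> / q \<theta> z)))"
  define G2 where "G2 = (\<lambda>z. q \<theta> z * (\<Sum>j\<in>UNIV. f j z * z_deriv j h z))"

  have ft1: "ft1 (x, y) * ?p x = a x * h (x, y) * ?r x y" if "x \<in> I1" "y \<in> I2" for x y
    using f(1)[OF that] ppos[OF that(1)] by (simp add: ft1_def f_def)
  have ft2: "ft2 (x, y) * ?r x y = (b x y - c x y * (a x / ?p x)) * h (x, y)" if "x \<in> I1" "y \<in> I2" for x y
    using f(2)[OF that] rpos[OF that] by (simp add: ft2_def f_def)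

  \<comment> \<open>\<open>F1\<close> is the derivative of \<open>ft1 * q1\<close>, and by
    \<open>ft1\<close> this product equals \<open>a * h * q2\<close>, whose factors are
    differentiable at \<open>x\<close> separately.\<close>
  have F1_eq: "F1 (x, y) = param_deriv i (\<lambda>\<eta>. q1 \<eta> x) \<theta> * h (x, y) * ?r x y
      + a x * z_deriv 1 h (x, y) * ?r x y + a x * h (x, y) * z_deriv 1 ?r2 (x, y)"
    if xy: "x \<in> I1" "y \<in> I2" and a': "(a has_real_derivative param_deriv i (\<lambda>\<eta>. q1 \<eta> x) \<theta>) (at x)"
      and p': "?p field_differentiable (at x)" and h': "(\<lambda>x. h (x, y)) field_differentiable (at x)"
      and r': "(\<lambda>x. ?r x y) field_differentiable (at x)" for x y
  proof -
    have d: "((\<lambda>x. a x * h (x, y) * ?r x y) has_real_derivative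
        (param_deriv i (\<lambda>\<eta>. q1 \<eta> x) \<theta> * h (x, y) + deriv (\<lambda>x. h (x, y)) x * a x) * ?r x y
          + deriv (\<lambda>x. ?r x y) x * (a x * h (x, y))) (at x)"
      using h' r' by (intro DERIV_mult a') (simp_all add: DERIV_deriv_iff_field_differentiable)
    have "deriv (\<lambda>x. ft1 (x, y)) x * ?p x + ft1 (x, y) * deriv ?p x
      = (param_deriv i (\<lambda>\<eta>. q1 \<eta> x) \<theta> * h (x, y) + deriv (\<lambda>x. h (x, y)) x * a x) * ?r x y
          + deriv (\<lambda>x. ?r x y) x * (a x * h (x, y))"
      using ppos ft1 xy by (intro deriv_mult_eq_if_mult_eq_on_open[OF opI(1) xy(1) _ _ p' d]) (auto, force)
    then show ?thesis
      by (simp add: F1_def z_deriv_def algebra_simps)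
  qed

  have F2_mult: "F2 (x, y) = ?p x * (deriv (\<lambda>y. ft2 (x, y)) y * ?r x y + ft2 (x, y) * deriv (?r x) y)"
    if "x \<in> I1" "y \<in> I2" for x y
  proof -
    have "?r x y \<noteq> 0" using rpos[OF that] by simp
    then show ?thesis
      by (simp add: F2_def z_deriv_def qeq distrib_left mult.assoc)
  qed

  \<comment> \<open>The pointwise identity almost everywhere\<close>
  have key: "AE x in lborel. AE y in lborel. (x, y) \<in> R \<longrightarrow> F1 (x, y) + F2 (x, y) = G1 (x, y) + G2 (x, y)"
  proof -
    have "AE x in lborel. x \<in> I1 \<longrightarrow> (a has_real_derivative param_deriv i (\<lambda>\<eta>. q1 \<eta> x) \<theta>) (at x)"
      using AE_interval_integral_has_derivative swap_psi1 unfolding a_def I1_def by blast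
    moreover have "AE x in lborel. x \<in> I1 \<longrightarrow> ?p field_differentiable (at x)"
      using loc_AC_AE_differentiable[OF q1_AC[OF \<Theta>(2)]] unfolding I1_def .
    moreover note ae_d1[OF h_ACL h_cont] ae_d1[OF q2_ACL[OF \<Theta>(2)] r_cont]
      ae_AC2[OF h_ACL] ae_AC2[OF q2_ACL[OF \<Theta>(2)]] ae_c
    moreover have "AE x in lborel. x \<in> I1 \<longrightarrow> loc_AC l2 u2 (\<lambda>y. ft2 (x, y))"
      using ae_lebesgue_on[OF ft2_AC[unfolded I1_def]] unfolding I1_def by eventually_elim simp
    ultimately show ?thesis
    proof eventually_elim
      case (elim x)
      show ?case
      proof (cases "x \<in> I1")
        case x: True
        define k where "k = (\<lambda>t. deriv (\<lambda>x. q2 \<theta> x t) x)"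
        have ACs: "loc_AC l2 u2 (\<lambda>y. h (x, y))" "loc_AC l2 u2 (?r x)" "loc_AC l2 u2 (\<lambda>y. ft2 (x, y))"
          using elim(5,6,8) x by simp_all
        note cont = ACs[THEN loc_AC_continuous_on, folded I2_def]
        \<comment> \<open>\<open>ae_c\<close> gives integrability only up to almost every
          \<open>y\<close>; a good endpoint beyond \<open>y\<close> provides it for each
          \<open>y\<close>, as the differentiation of \<open>C x\<close> demands.\<close>
        have kint: "interval_lebesgue_integrable lebesgue l2 (ereal y) k" if y: "y \<in> einterval l2 u2" for y
        proof -
          have "AE y in lborel. y \<in> einterval l2 u2 \<longrightarrow> interval_lebesgue_integrable lebesgue l2 (ereal y) k"
            using elim(7) by eventually_elim (use x in \<open>auto simp: k_def I2_def\<close>)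
          from exists_between_if_AE[OF this y]
          obtain y' where "y < y'" "interval_lebesgue_integrable lebesgue l2 (ereal y') k"
            by (elim bexE conjE)
          then show ?thesis
            using y by (intro interval_lebesgue_integrable_mono[of l2 y' k y]) (auto simp: einterval_def)
        qed
        have C: "AE y in lborel. y \<in> I2 \<longrightarrow> (C x has_real_derivative k y) (at y)" "continuous_on I2 (C x)"
          using interval_integral_primitive[OF kint] unfolding C_def I2_def k_def by simp_all
        have b: "AE y in lborel. y \<in> I2 \<longrightarrow> (b x has_real_derivative param_deriv i (\<lambda>\<eta>. q2 \<eta> x y) \<theta>) (at y)"
          "continuous_on I2 (b x)"
        proof -
          have "interval_lebesgue_integrable lebesgue l2 (ereal y) (\<lambda>t. param_deriv i (\<lambda>\<eta>. q2 \<eta> x t) \<theta>)"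
            if "y \<in> einterval l2 u2" for y
            using swap_psi2[OF x] that unfolding I2_def by blast
          from interval_integral_primitive[OF this]
          show "AE y in lborel. y \<in> I2 \<longrightarrow> (b x has_real_derivative param_deriv i (\<lambda>\<eta>. q2 \<eta> x y) \<theta>) (at y)"
            "continuous_on I2 (b x)"
            unfolding b_def I2_def by simp_all
        qed
        \<comment> \<open>\<open>c = C\<close> is known only for almost every \<open>y\<close>, which does not suffice for differentiating;
          continuity of both sides upgrades the identity to all \<open>y\<close>.\<close>
        have ft2C: "ft2 (x, y) * ?r x y = (b x y - C x y * (a x / ?p x)) * h (x, y)" if "y \<in> I2" for y
        proof (rule AE_eq_continuous_on_open[OF opI(2) _ _ _ that])
          show "AE y in lborel. y \<in> I2 \<longrightarrow> ft2 (x, y) * ?r x y = (b x y - C x y * (a x / ?p x)) * h (x, y)"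
            using elim(7) by eventually_elim (use x ft2 in auto)
        qed (intro continuous_intros cont b(2) C(2))+
        have dy: "AE y in lborel. y \<in> I2 \<longrightarrow> (\<lambda>y. h (x, y)) field_differentiable (at y)"
          "AE y in lborel. y \<in> I2 \<longrightarrow> ?r x field_differentiable (at y)"
          using ACs[THEN loc_AC_AE_differentiable] unfolding I2_def by blast+
        show ?thesis
          using elim(3,4,7) C(1) b(1) dy
        proof eventually_elim
          case (elim y)
          show ?case
          proof
            assume "(x, y) \<in> R"
            then have y: "y \<in> I2" using R(2) by simp
            have d: "((\<lambda>y. (b x y - C x y * (a x / ?p x)) * h (x, y)) has_real_derivative
                (param_deriv i (\<lambda>\<eta>. q2 \<eta> x y) \<theta> - k y * (a x / ?p x)) * h (x, y)
                  + deriv (\<lambda>y. h (x, y)) y * (b x y - C x y * (a x / ?p x))) (at y)"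
              using elim y
              by (intro DERIV_mult DERIV_diff DERIV_cmult_right) (simp_all add: DERIV_deriv_iff_field_differentiable)
            have "deriv (\<lambda>y. ft2 (x, y)) y * ?r x y + ft2 (x, y) * deriv (?r x) y
              = (param_deriv i (\<lambda>\<eta>. q2 \<eta> x y) \<theta> - k y * (a x / ?p x)) * h (x, y)
                  + deriv (\<lambda>y. h (x, y)) y * (b x y - C x y * (a x / ?p x))"
            proof (rule deriv_mult_eq_if_mult_eq_on_open[OF opI(2) y ft2C _ _ d])
              show "?r x y \<noteq> 0" if "y \<in> I2" for y
                using rpos[OF x that] by simp
              show "?r x field_differentiable (at y)"
                using elim y by simp
            qed
            then have F2: "F2 (x, y) = ?p x * ((param_deriv i (\<lambda>\<eta>. q2 \<eta> x y) \<theta> - k y * (a x / ?p x)) * h (x, y)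
                  + deriv (\<lambda>y. h (x, y)) y * (b x y - C x y * (a x / ?p x)))"
              using F2_mult[OF x y] by simp
            \<comment> \<open>The \<open>z1\<close>-derivative of \<open>q2\<close> is
              \<open>k y\<close>, so the last summand cancels against the \<open>k y\<close> term of
              \<open>F2\<close>.\<close>
            have F1: "F1 (x, y) = param_deriv i (\<lambda>\<eta>. q1 \<eta> x) \<theta> * h (x, y) * ?r x y
                + a x * z_deriv 1 h (x, y) * ?r x y + a x * h (x, y) * k y"
              using F1_eq[OF x y] \<open>x \<in> I1 \<longrightarrow> (a has_real_derivative _) (at x)\<close>
                \<open>x \<in> I1 \<longrightarrow> ?p field_differentiable (at x)\<close> elim x y R(2)
              by (simp add: k_def z_deriv_def)
            \<comment> \<open>\<open>f 2\<close> is expressed through \<open>c\<close>. No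
              derivative of \<open>c\<close> is taken here, so equality at this one \<open>y\<close>
              is enough.\<close>
            have "c x y = C x y" using elim x y by simp
            then have G2: "G2 (x, y) = ?p x * ?r x y * (a x / ?p x * z_deriv 1 h (x, y)
                + (b x y - C x y * (a x / ?p x)) / ?r x y * deriv (\<lambda>y. h (x, y)) y)"
              by (simp add: G2_def sum_2 f[OF x y] qeq z_deriv_def)
            have G1: "G1 (x, y) = h (x, y) * (param_deriv i (\<lambda>\<eta>. q1 \<eta> x) \<theta> * ?r x y
                + ?p x * param_deriv i (\<lambda>\<eta>. q2 \<eta> x y) \<theta>)"
              using ppos[OF x] rpos[OF x y] by (simp add: G1_def dq[OF x y] qeq)
            show "F1 (x, y) + F2 (x, y) = G1 (x, y) + G2 (x, y)"
              unfolding F1 F2 G1 G2 using ppos[OF x] rpos[OF x y]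
              by (simp add: field_simps)
          qed
        qed
      qed (simp add: R(2))
    qed
  qed

  \<comment> \<open>Integrability over the plane\<close>
  have Rm: "R \<in> sets lebesgue" using R(1) by auto
  have q_nonneg: "0 \<le> q \<theta> z" if "z \<in> R" for z
    using that ppos rpos R(2) by (cases z) (auto simp: qeq intro!: mult_nonneg_nonneg less_imp_le)
  have Q: "Q \<theta> = dens_measure R (q \<theta>)"
    by (simp add: Q_def R_def q_def)
  have dens: "integrable lebesgue (\<lambda>z. indicator R z * (q \<theta> z * \<phi> z))"
    "(LINT z|Q \<theta>. \<phi> z) = (LINT z|lebesgue. indicator R z * (q \<theta> z * \<phi> z))"
    if "integrable (Q \<theta>) \<phi>" for \<phi>
    using that unfolding Q by (auto intro!: integral_dens_measure R(1) q_cont[OF \<Theta>(2)] q_nonneg)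

  have F1i: "integrable lebesgue (\<lambda>z. indicator R z * F1 z)"
    using Bochner_Integration.integrable_add[OF int1[unfolded set_integrable_def] int2[unfolded set_integrable_def]]
    by (simp add: F1_def algebra_simps)
  have F2i: "integrable lebesgue (\<lambda>z. indicator R z * F2 z)"
    using Bochner_Integration.integrable_add[OF dens(1)[OF int3] dens(1)[OF int4]]
    by (simp add: F2_def algebra_simps)
  have G1i: "integrable lebesgue (\<lambda>z. indicator R z * G1 z)"
    using dens(1)[OF int6] by (simp add: G1_def)
  have G2i: "integrable lebesgue (\<lambda>z. indicator R z * G2 z)"
    using dens(1)[OF int7] by (simp add: G2_def)

  \<comment> \<open>Vanishing integrals and conclusion\<close>
  have "(LINT z|lebesgue. indicator R z * F1 z) = 0"
  \<comment> \<open>\<open>F1\<close> is a derivative in \<open>z1\<close>, so \<open>z1\<close> is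
    the inner variable of integration.\<close>
  proof (rule integral_lebesgue_eq_0_if_sections[OF F1i], rule disjI2)
    have "AE y in lborel. y \<in> I2 \<longrightarrow> loc_AC l1 u1 (\<lambda>x. ft1 (x, y)) \<and>
          vanishes_at_ends l1 u1 (\<lambda>x. ft1 (x, y) * ?p x)"
      using ae_lebesgue_on[OF ft1_AC[unfolded I2_def]] unfolding I2_def .
    then show "AE y in lborel. integrable lebesgue (\<lambda>x. indicator R (x, y) * F1 (x, y)) \<longrightarrow>
        (LINT x|lebesgue. indicator R (x, y) * F1 (x, y)) = 0"
    proof eventually_elim
      case (elim y)
      show ?case
      proof (cases "y \<in> I2")
        case True
        have eq: "indicator R (x, y) * F1 (x, y)
          = indicator (einterval l1 u1) x *\<^sub>R (deriv (\<lambda>x. ft1 (x, y)) x * ?p x + ft1 (x, y) * deriv ?p x)" for x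
          using True by (simp add: indicator_def R(2) F1_def z_deriv_def I1_def)
        show ?thesis
          unfolding eq
          using loc_AC_integral_derivative_mult_eq_0[OF lu(1) _ q1_AC[OF \<Theta>(2)], of "\<lambda>x. ft1 (x, y)"] elim True
          by (simp add: set_integrable_def set_lebesgue_integral_def)
      qed (simp add: indicator_def R(2))
    qed
  qed
  moreover have "(LINT z|lebesgue. indicator R z * F2 z) = 0"
  \<comment> \<open>Here \<open>z2\<close> is the inner variable, and \<open>q1\<close> is a
    constant factor of each section.\<close>
  proof (rule integral_lebesgue_eq_0_if_sections[OF F2i], rule disjI1)
    have "AE x in lborel. x \<in> I1 \<longrightarrow> loc_AC l2 u2 (\<lambda>y. ft2 (x, y)) \<and>
          vanishes_at_ends l2 u2 (\<lambda>y. ft2 (x, y) * ?r x y)"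
      using ae_lebesgue_on[OF ft2_AC[unfolded I1_def]] unfolding I1_def .
    moreover note ae_AC2[OF q2_ACL[OF \<Theta>(2)]]
    ultimately show "AE x in lborel. integrable lebesgue (\<lambda>y. indicator R (x, y) * F2 (x, y)) \<longrightarrow>
        (LINT y|lebesgue. indicator R (x, y) * F2 (x, y)) = 0"
    proof eventually_elim
      case (elim x)
      show ?case
      proof (cases "x \<in> I1")
        case True
        have eq: "indicator R (x, y) * F2 (x, y) = ?p x * (indicator (einterval l2 u2) y *\<^sub>R
            (deriv (\<lambda>y. ft2 (x, y)) y * ?r x y + ft2 (x, y) * deriv (?r x) y))" for y
          using True F2_mult[of x y] by (simp add: indicator_def R(2) I2_def)
        show ?thesis
          unfolding eq
          using loc_AC_integral_derivative_mult_eq_0[OF lu(2), of "\<lambda>y. ft2 (x, y)" "?r x"] elim True ppos[OF True]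
          by (simp add: set_integrable_def set_lebesgue_integral_def)
      qed (simp add: indicator_def R(2))
    qed
  qed
  \<comment> \<open>\<open>key\<close> is an iterated almost-everywhere statement. It is used
    through sections: the difference of both sides is integrable on the plane, and almost all its
    sections vanish almost everywhere.\<close>
  moreover have "(LINT z|lebesgue. indicator R z * F1 z + indicator R z * F2 z
      - (indicator R z * G1 z + indicator R z * G2 z)) = 0"
  proof (rule integral_lebesgue_eq_0_if_sections, rule_tac [2] disjI1)
    show "integrable lebesgue (\<lambda>z. indicator R z * F1 z + indicator R z * F2 z
      - (indicator R z * G1 z + indicator R z * G2 z))"
      by (intro Bochner_Integration.integrable_add Bochner_Integration.integrable_diff F1i F2i G1i G2i)
    show "AE x in lborel.
        integrable lebesgue (\<lambda>y. indicator R (x, y) * F1 (x, y) + indicator R (x, y) * F2 (x, y)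
          - (indicator R (x, y) * G1 (x, y) + indicator R (x, y) * G2 (x, y))) \<longrightarrow>
        (LINT y|lebesgue. indicator R (x, y) * F1 (x, y) + indicator R (x, y) * F2 (x, y)
          - (indicator R (x, y) * G1 (x, y) + indicator R (x, y) * G2 (x, y))) = 0"
      using key
    proof eventually_elim
      case (elim x)
      have "AE y in lebesgue. indicator R (x, y) * F1 (x, y) + indicator R (x, y) * F2 (x, y)
          - (indicator R (x, y) * G1 (x, y) + indicator R (x, y) * G2 (x, y)) = 0"
        using AE_completion[OF elim] by eventually_elim (simp add: indicator_def)
      then show ?case
        by (intro impI integral_eq_zero_AE)
    qed
  qed
  ultimately have "(LINT z|lebesgue. indicator R z * G1 z) = - (LINT z|lebesgue. indicator R z * G2 z)"
    using F1i F2i G1i G2i by simp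
  then have "(LINT z|Q \<theta>. h z * (param_deriv i (\<lambda>\<eta>. q \<eta> z) \<theta> / q \<theta> z))
      = - (LINT z|Q \<theta>. (\<Sum>j\<in>UNIV. f j z * z_deriv j h z))"
    using dens(2)[OF int6] dens(2)[OF int7] by (simp add: G1_def G2_def)
  with swap_E show ?thesis
    by simp
qed

end
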